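(* Let $q\ge 8$ be a prime power. Let $\mathrm{PG}(6,q)$ have hyperplane at infinity $\Sigma_\infty$ and let $\mathcal S$ be a regular 2-spread in $\Sigma_\infty$ with transversal lines $g,g^q,g^{q^2}$. Then an $r$-dimensional 3-special normal rational curve $\mathcal N_r$ in $\mathrm{PG}(6,q)$ is one of the following. 1. $r=6$ and $\mathcal N_6^\star\cap\Sigma_\infty^\star=\{P,P^q,P^{q^2},Q,Q^q,Q^{q^2}\}$ for some $P,Q\in g$, possibly repeated. 2. $r=6$ and $\mathcal N_6^{\star\star}\cap\Sigma_\infty^{\star\star}=\{P,P^q,P^{q^2},P^{q^3},P^{q^4},P^{q^5}\}$ for some $P\in g^{\star\star}\setminus g$. 3. $r=4$ and $\mathcal N_4\cap\Sigma_\infty=\{T\}$ and $\mathcal N_4^\star\cap\Sigma_\infty^\star=\{T,P,P^q,P^{q^2}\}$, $P\in g$, with $T\notin\langle P,P^q,P^{q^2}\rangle$. 4. $r=3$ and $\mathcal N_3^\star\cap\Sigma_\infty^\star=\{R,R^q,R^{q^2}\}$ where $R\in XY^q$ (the line joining $X$ and $Y^q$) for some distinct $X,Y\in g$, $R\ne X,Y^q$. 5. $r=2$ and $\mathcal N_2\cap\Sigma_\infty=\{P,Q\}$ with $P,Q\in\Sigma_\infty$ (possibly repeated). 6. $r=2$ and $\mathcal N_2^{\star\star}\cap\Sigma_\infty^{\star\star}=\{P,P^{q^3}\}$ with $P\in\Sigma_\infty^{\star\star}\setminus\Sigma_\infty^{\star}$, $P$ not in an extended transversal line.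
   Context: **Normal rational curves.** An $r$-dimensional normal rational curve ($r$-dim nrc) in $\mathrm{PG}(n,q)$, $q\ge r$, is a set of points lying in an $r$-space and projectively equivalent to $\{(1,\theta,\dots,\theta^r):\theta\in\mathbb F_q\}\cup\{(0,\dots,0,1)\}$; it extends naturally to an $r$-dim nrc over extension fields. An $r$-dim nrc $\mathcal N_r$ of $\mathrm{PG}(6,q)$ not contained in $\Sigma_\infty$ meets $\Sigma_\infty$ in $r$ points, possibly repeated or in an extension. **Extensions.** For a subspace or nrc $\mathcal K$ of $\mathrm{PG}(6,q)$, $\mathcal K^\star$ and $\mathcal K^{\star\star}$ denote its natural extensions to $\mathrm{PG}(6,q^3)$ and $\mathrm{PG}(6,q^6)$; $g^{\star\star}$ is the extension of the line $g$ of $\mathrm{PG}(6,q^3)$ to $\mathrm{PG}(6,q^6)$. $X^q$ is obtained from $X$ by raising coordinates to the $q$-th power. **Regular 2-spread.** A regular 2-spread $\mathcal S$ of $\Sigma_\infty\cong\mathrm{PG}(5,q)$ is obtained from a line $g$ of $\Sigma_\infty^\star\cong\mathrm{PG}(5,q^3)$ disjoint from $\Sigma_\infty$ such that $g,g^q,g^{q^2}$ span $\Sigma_\infty^\star$: its elements are the planes $\langle X,X^q,X^{q^2}\rangle\cap\Sigma_\infty$, $X\in g$. The lines $g,g^q,g^{q^2}$ are its transversal lines; their extensions to $\Sigma_\infty^{\star\star}\cong\mathrm{PG}(5,q^6)$ are the extended transversal lines, and the extensions of the planes of $\mathcal S$ are the extended planes of $\mathcal S$. **$\mathcal S$-good points.**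 For a point $P$ of $\Sigma_\infty^{\star\star}$: the weight is $w(P)=1$ if $P$ lies on an extended transversal line of $\mathcal S$; $w(P)=2$ if $w(P)\ne1$ and $P$ lies on a line meeting two of the extended transversal lines; $w(P)=3$ otherwise. $o(P)$ is the size of the orbit of $P$ under the collineation $X\mapsto X^q$. $s(P)=1$ if $P$ lies in an extended plane of $\mathcal S$, and $s(P)=2$ otherwise. $P$ is $\mathcal S$-good if $w(P)\times o(P)=3s(P)$. **3-special.** Let $\mathcal N_r$, $r\le6$, be an $r$-dim nrc of $\mathrm{PG}(6,q)$ not contained in $\Sigma_\infty$, meeting $\Sigma_\infty$ in the $r$ points $P_1,\dots,P_r$ (possibly repeated or in an extension). $\mathcal N_r$ is 3-special (with respect to $\mathcal S$) if $w(P_1)+\cdots+w(P_r)=6$ and each $P_i$ is $\mathcal S$-good. *)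

theory Defs
  imports "HOL-Analysis.Analysis" "HOL-Computational_Algebra.Computational_Algebra"
begin

text \<open>
  All projective geometries live over one algebraically closed field \<open>'k\<close> whose characteristic
  is the prime dividing \<open>q\<close>. The field with \<open>q ^ d\<close> elements is the set \<open>GF q d\<close> below, and
  PG(6,\<open>q ^ d\<close>) is the set \<open>PG q d\<close> of those points of the projective space of \<open>'k ^ 7\<close> that
  have a representative with coordinates in \<open>GF q d\<close>. A point is a one-dimensional subspace
  of \<open>'k ^ 7\<close>, so the inclusions between PG(6,q), PG(6,\<open>q ^ 3\<close>) and PG(6,\<open>q ^ 6\<close>) are inclusions
  of sets.
\<close>

definition GF :: "nat \<Rightarrow> nat \<Rightarrow> 'k::field set" where
  "GF q d = {x. x ^ (q ^ d) = x}"

definition rational_vec :: "nat \<Rightarrow> nat \<Rightarrow> 'k::field ^ 7 \<Rightarrow> bool" where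
  "rational_vec q d v \<longleftrightarrow> (\<forall>i. v $ i \<in> GF q d)"

definition pt :: "'k::field ^ 7 \<Rightarrow> ('k ^ 7) set" where
  "pt v = vec.span {v}"

definition PG :: "nat \<Rightarrow> nat \<Rightarrow> ('k::field ^ 7) set set" where
  "PG q d = {pt v | v. v \<noteq> 0 \<and> rational_vec q d v}"

text \<open>The map \<open>X \<mapsto> X\<^sup>q\<close> on points; on a set \<open>A\<close> of points it acts as \<open>frob q ` A\<close>.\<close>

definition frob :: "nat \<Rightarrow> ('k::field ^ 7) set \<Rightarrow> ('k ^ 7) set" where
  "frob q P = (\<lambda>v. \<chi> i. (v $ i) ^ q) ` P"

text \<open>
  \<open>pg_span q d A\<close> is the set of points of PG(6,\<open>q ^ d\<close>) in the subspace generated by a set \<open>A\<close>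
  of points. When \<open>A\<close> is a subspace of a smaller PG(6,\<open>q ^ e\<close>), this is the natural
  extension of \<open>A\<close>.
\<close>

definition pg_span :: "nat \<Rightarrow> nat \<Rightarrow> ('k::field ^ 7) set set \<Rightarrow> ('k ^ 7) set set" where
  "pg_span q d A = {P \<in> PG q d. P \<subseteq> vec.span (\<Union>A)}"

definition pg_subspace :: "nat \<Rightarrow> nat \<Rightarrow> nat \<Rightarrow> ('k::field ^ 7) set set \<Rightarrow> bool" where
  "pg_subspace q d k A \<longleftrightarrow>
     A \<subseteq> PG q d \<and> pg_span q d A = A \<and> vec.dim (\<Union>A) = k + 1"

text \<open>
  A hyperplane of PG(6,q) is given by the coefficient vector \<open>h\<close> of its equation; \<open>hyp q d h\<close>
  is its extension to PG(6,\<open>q ^ d\<close>).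
\<close>

definition lin_form :: "'k::field ^ 7 \<Rightarrow> 'k ^ 7 \<Rightarrow> 'k" where
  "lin_form h x = (\<Sum>i\<in>UNIV. h $ i * x $ i)"

definition hyp :: "nat \<Rightarrow> nat \<Rightarrow> 'k::field ^ 7 \<Rightarrow> ('k ^ 7) set set" where
  "hyp q d h = {P \<in> PG q d. \<forall>x\<in>P. lin_form h x = 0}"

subsection \<open>Regular 2-spreads\<close>

definition transversal_line :: "nat \<Rightarrow> 'k::field ^ 7 \<Rightarrow> ('k ^ 7) set set \<Rightarrow> bool" where
  "transversal_line q h g \<longleftrightarrow>
     pg_subspace q 3 1 g \<and> g \<subseteq> hyp q 3 h \<and> g \<inter> hyp q 1 h = {} \<and>
     pg_span q 3 (g \<union> frob q ` g \<union> frob q ` frob q ` g) = hyp q 3 h"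

definition regular_spread ::
    "nat \<Rightarrow> 'k::field ^ 7 \<Rightarrow> ('k ^ 7) set set \<Rightarrow> ('k ^ 7) set set set" where
  "regular_spread q h g =
     {pg_span q 3 {X, frob q X, frob q (frob q X)} \<inter> hyp q 1 h | X. X \<in> g}"

definition ext_transversals ::
    "nat \<Rightarrow> ('k::field ^ 7) set set \<Rightarrow> ('k ^ 7) set set set" where
  "ext_transversals q g =
     {pg_span q 6 g, pg_span q 6 (frob q ` g), pg_span q 6 (frob q ` frob q ` g)}"

definition weight :: "nat \<Rightarrow> ('k::field ^ 7) set set \<Rightarrow> ('k ^ 7) set \<Rightarrow> nat" where
  "weight q g P =
     (if \<exists>t\<in>ext_transversals q g. P \<in> t then 1
      else if \<exists>l. pg_subspace q 6 1 l \<and> P \<in> l \<and>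
                 (\<exists>t\<in>ext_transversals q g. \<exists>t'\<in>ext_transversals q g.
                    t \<noteq> t' \<and> l \<inter> t \<noteq> {} \<and> l \<inter> t' \<noteq> {}) then 2
      else 3)"

definition orbit_size :: "nat \<Rightarrow> ('k::field ^ 7) set \<Rightarrow> nat" where
  "orbit_size q P = card (range (\<lambda>i. (frob q ^^ i) P))"

definition spread_index ::
    "nat \<Rightarrow> 'k::field ^ 7 \<Rightarrow> ('k ^ 7) set set \<Rightarrow> ('k ^ 7) set \<Rightarrow> nat" where
  "spread_index q h g P = (if \<exists>\<pi>\<in>regular_spread q h g. P \<in> pg_span q 6 \<pi> then 1 else 2)"

definition S_good :: "nat \<Rightarrow> 'k::field ^ 7 \<Rightarrow> ('k ^ 7) set set \<Rightarrow> ('k ^ 7) set \<Rightarrow> bool" where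
  "S_good q h g P \<longleftrightarrow>
     P \<in> hyp q 6 h \<and> weight q g P * orbit_size q P = 3 * spread_index q h g P"

subsection \<open>Normal rational curves\<close>

text \<open>
  An r-dimensional nrc of PG(6,q) is given by a frame \<open>c 0, \<dots>, c r\<close> over GF(q): the images of
  the standard basis under a projectivity that maps the standard nrc of PG(r,q) to it. The
  frame turns \<open>(1, \<theta>, \<dots>, \<theta>\<^sup>r)\<close> into \<open>curve_vec r c \<theta>\<close> and \<open>(0, \<dots>, 0, 1)\<close> into \<open>c r\<close>. The same
  frame over GF(\<open>q ^ d\<close>) gives the extension \<open>curve q d r c\<close>; the nrc itself is \<open>curve q 1 r c\<close>.
\<close>

definition nrc_frame :: "nat \<Rightarrow> nat \<Rightarrow> (nat \<Rightarrow> 'k::field ^ 7) \<Rightarrow> bool" where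
  "nrc_frame q r c \<longleftrightarrow>
     1 \<le> r \<and> r \<le> q \<and> (\<forall>i\<le>r. rational_vec q 1 (c i)) \<and>
     inj_on c {..r} \<and> vec.independent (c ` {..r})"

definition curve_vec :: "nat \<Rightarrow> (nat \<Rightarrow> 'k::field ^ 7) \<Rightarrow> 'k \<Rightarrow> 'k ^ 7" where
  "curve_vec r c \<theta> = (\<Sum>i\<le>r. \<theta> ^ i *s c i)"

definition curve :: "nat \<Rightarrow> nat \<Rightarrow> nat \<Rightarrow> (nat \<Rightarrow> 'k::field ^ 7) \<Rightarrow> ('k ^ 7) set set" where
  "curve q d r c = (\<lambda>\<theta>. pt (curve_vec r c \<theta>)) ` GF q d \<union> {pt (c r)}"

text \<open>
  The hyperplane \<open>h\<close> meets the curve where the binary form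
  \<open>\<Sum>i\<le>r. lin_form h (c i) * s ^ (r - i) * t ^ i\<close> vanishes. \<open>curve_poly\<close> is this form at \<open>s = 1\<close>,
  so the point \<open>c r\<close> (at \<open>s = 0\<close>) is counted \<open>r - degree\<close> times. \<open>meet_pts\<close> consists of the r
  points \<open>P\<^sub>1, \<dots>, P\<^sub>r\<close>, possibly repeated or in an extension, and \<open>meet_pts_over q d\<close>
  of those defined over GF(\<open>q ^ d\<close>), with the same multiplicities.
\<close>

definition curve_poly :: "nat \<Rightarrow> 'k::field ^ 7 \<Rightarrow> (nat \<Rightarrow> 'k ^ 7) \<Rightarrow> 'k poly" where
  "curve_poly r h c = (\<Sum>i\<le>r. monom (lin_form h (c i)) i)"

definition meet_pts :: "nat \<Rightarrow> 'k::field ^ 7 \<Rightarrow> (nat \<Rightarrow> 'k ^ 7) \<Rightarrow> ('k ^ 7) set multiset" where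
  "meet_pts r h c =
     image_mset (\<lambda>\<theta>. pt (curve_vec r c \<theta>)) (proots (curve_poly r h c))
     + replicate_mset (r - degree (curve_poly r h c)) (pt (c r))"

definition meet_pts_over ::
    "nat \<Rightarrow> nat \<Rightarrow> nat \<Rightarrow> 'k::field ^ 7 \<Rightarrow> (nat \<Rightarrow> 'k ^ 7) \<Rightarrow> ('k ^ 7) set multiset" where
  "meet_pts_over q d r h c = filter_mset (\<lambda>P. P \<in> PG q d) (meet_pts r h c)"

definition three_special ::
    "nat \<Rightarrow> 'k::field ^ 7 \<Rightarrow> ('k ^ 7) set set \<Rightarrow> nat \<Rightarrow> (nat \<Rightarrow> 'k ^ 7) \<Rightarrow> bool" where
  "three_special q h g r c \<longleftrightarrow>
     r \<le> 6 \<and> \<not> curve q 1 r c \<subseteq> hyp q 1 h \<and>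
     (\<Sum>P\<in>#meet_pts r h c. weight q g P) = 6 \<and>
     (\<forall>P\<in>#meet_pts r h c. S_good q h g P)"

text \<open>
  Two checks on the intersection multisets: there are r points in all, and the ones over
  GF(\<open>q ^ d\<close>) are the common points of the extended curve and the extended hyperplane.
\<close>

lemma degree_curve_poly: "degree (curve_poly r h c) \<le> r"
  unfolding curve_poly_def
  by (intro degree_sum_le) (auto intro: order.trans[OF degree_monom_le])

lemma size_meet_pts:
  fixes c :: "nat \<Rightarrow> 'k::alg_closed_field ^ 7"
  shows "size (meet_pts r h c) = r"
proof -
  let ?f = "curve_poly r h c"
  have "size (proots ?f) = degree ?f"
  proof (cases "?f = 0")
    case False
    then obtain A where A: "size A = degree ?f"
      "?f = smult (lead_coeff ?f) (\<Prod>x\<in>#A. [:-x, 1:])"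
      using alg_closed_imp_factorization by blast
    have "proots ?f = proots (\<Prod>x\<in>#A. [:-x, 1:])"
      using False by (subst A(2)) simp
    also have "\<dots> = A"
    proof (induction A)
      case (add x A)
      have "(\<Prod>y\<in>#A. [:-y, 1:]) \<noteq> 0"
        by (auto simp: prod_mset_zero_iff)
      then have "proots ([:-x, 1:] * (\<Prod>y\<in>#A. [:-y, 1:])) = {#x#} + A"
        using add by (subst proots_mult) (simp_all del: mult_pCons_left)
      then show ?case by simp
    qed simp
    finally show ?thesis using A(1) by simp
  qed simp
  then show ?thesis
    using degree_curve_poly[of r h c] by (simp add: meet_pts_def)
qed

lemma GF_power: "x \<in> GF q 1 \<Longrightarrow> x \<in> GF q d"
  by (induction d) (auto simp: GF_def power_mult)

lemma power_q_sum:
  fixes f :: "'a \<Rightarrow> 'k::field"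
  assumes "q = CHAR('k) ^ m" "0 < CHAR('k)"
  shows "(\<Sum>i\<in>A. f i) ^ (q ^ d) = (\<Sum>i\<in>A. f i ^ (q ^ d))"
proof -
  have "prime CHAR('k)"
    using assms(2) by (simp add: prime_CHAR_semidom)
  then show ?thesis
    unfolding assms(1) power_mult[symmetric] by (rule freshmans_dream_sum'[OF _ refl])
qed

lemma frame_coeffs:
  fixes c :: "nat \<Rightarrow> 'k::field ^ 7"
  assumes "nrc_frame q r c" "(\<Sum>i\<le>r. a i *s c i) = 0" "i \<le> r"
  shows "a i = 0"
proof -
  have inj: "inj_on c {..r}" and ind: "vec.independent (c ` {..r})"
    using assms(1) by (auto simp: nrc_frame_def)
  have "(\<Sum>v\<in>c ` {..r}. a (the_inv_into {..r} c v) *s v) = (\<Sum>i\<le>r. a i *s c i)"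
    by (subst sum.reindex[OF inj]) (auto intro!: sum.cong simp: the_inv_into_f_f[OF inj])
  then have "a (the_inv_into {..r} c (c i)) = 0"
    using vec.independentD[OF ind, of "c ` {..r}" "\<lambda>v. a (the_inv_into {..r} c v)" "c i"] assms
    by auto
  then show ?thesis
    using assms(3) by (simp add: the_inv_into_f_f[OF inj])
qed

lemma curve_vec_nonzero:
  assumes "nrc_frame q r c"
  shows "curve_vec r c \<theta> \<noteq> 0"
  using frame_coeffs[OF assms, of "\<lambda>i. \<theta> ^ i" 0] by (auto simp: curve_vec_def)

lemma frame_last_nonzero:
  assumes "nrc_frame q r c"
  shows "c r \<noteq> 0"
proof
  assume "c r = 0"
  then have "(\<Sum>i\<le>r. (if i = r then 1 else 0) *s c i) = 0"
    by (intro sum.neutral) auto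
  from frame_coeffs[OF assms this, of r] show False by simp
qed

lemma pt_subset_lin_form: "(\<forall>x\<in>pt v. lin_form h x = 0) \<longleftrightarrow> lin_form h v = 0"
proof
  assume "lin_form h v = 0"
  moreover have "lin_form h (k *s v) = k * lin_form h v" for k
    by (simp add: lin_form_def sum_distrib_left mult.left_commute)
  ultimately show "\<forall>x\<in>pt v. lin_form h x = 0"
    by (auto simp: pt_def vec.span_singleton)
qed (auto simp: pt_def vec.span_base)

lemma lin_form_curve_vec: "lin_form h (curve_vec r c \<theta>) = poly (curve_poly r h c) \<theta>"
proof -
  have "lin_form h (curve_vec r c \<theta>) = (\<Sum>j\<in>UNIV. \<Sum>i\<le>r. h $ j * (\<theta> ^ i * c i $ j))"
    by (simp add: lin_form_def curve_vec_def sum_distrib_left)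
  also have "\<dots> = (\<Sum>i\<le>r. \<Sum>j\<in>UNIV. h $ j * (\<theta> ^ i * c i $ j))"
    by (rule sum.swap)
  also have "\<dots> = poly (curve_poly r h c) \<theta>"
    by (simp add: curve_poly_def poly_sum poly_monom lin_form_def sum_distrib_left
        sum_distrib_right mult_ac)
  finally show ?thesis .
qed

lemma coeff_curve_poly: "i \<le> r \<Longrightarrow> coeff (curve_poly r h c) i = lin_form h (c i)"
  by (simp add: curve_poly_def coeff_sum)

lemma power_q_curve_vec:
  fixes c :: "nat \<Rightarrow> 'k::field ^ 7"
  assumes q: "q = CHAR('k) ^ m" "0 < CHAR('k)" and c: "nrc_frame q r c"
  shows "(curve_vec r c \<theta> $ j) ^ (q ^ d) = curve_vec r c (\<theta> ^ (q ^ d)) $ j"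
proof -
  have "(c i $ j) ^ (q ^ d) = c i $ j" if "i \<le> r" for i
    using c that GF_power[of "c i $ j" q d]
    by (auto simp: nrc_frame_def rational_vec_def GF_def)
  then show ?thesis
    by (auto simp: curve_vec_def power_q_sum[OF q] power_mult_distrib
        power_mult[symmetric] mult.commute intro!: sum.cong)
qed

lemma curve_subset_PG:
  fixes c :: "nat \<Rightarrow> 'k::field ^ 7"
  assumes q: "q = CHAR('k) ^ m" "0 < CHAR('k)" and c: "nrc_frame q r c"
  shows "curve q d r c \<subseteq> PG q d"
proof -
  have "rational_vec q d (curve_vec r c \<theta>)" if "\<theta> \<in> GF q d" for \<theta>
    using that power_q_curve_vec[OF q c] by (simp add: rational_vec_def GF_def)
  moreover have "rational_vec q d (c r)"
    using c by (auto simp: nrc_frame_def rational_vec_def intro: GF_power[unfolded One_nat_def])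
  ultimately show ?thesis
    using curve_vec_nonzero[OF c] frame_last_nonzero[OF c] by (auto simp: curve_def PG_def)
qed

lemma curve_param_rational:
  fixes c :: "nat \<Rightarrow> 'k::field ^ 7"
  assumes q: "q = CHAR('k) ^ m" "0 < CHAR('k)" and c: "nrc_frame q r c"
    and P: "pt (curve_vec r c \<theta>) \<in> PG q d"
  shows "\<theta> \<in> GF q d"
proof -
  let ?v = "curve_vec r c \<theta>" and ?Q = "q ^ d"
  obtain w where w: "pt ?v = pt w" "rational_vec q d w"
    using P by (auto simp: PG_def)
  have "?v \<in> pt w"
    using vec.span_base[of ?v "{?v}"] w(1) by (simp add: pt_def)
  then obtain k where k: "?v = k *s w"
    by (auto simp: pt_def vec.span_singleton)
  with curve_vec_nonzero[OF c] have k0: "k \<noteq> 0" by auto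
  define \<mu> where "\<mu> = k ^ ?Q / k"
  have "curve_vec r c (\<theta> ^ ?Q) $ j = (\<mu> *s ?v) $ j" for j
  proof -
    have "curve_vec r c (\<theta> ^ ?Q) $ j = (?v $ j) ^ ?Q"
      by (simp add: power_q_curve_vec[OF q c])
    also have "\<dots> = k ^ ?Q * (w $ j) ^ ?Q"
      by (simp add: k power_mult_distrib)
    also have "(w $ j) ^ ?Q = w $ j"
      using w(2) by (simp add: rational_vec_def GF_def)
    finally show ?thesis
      using k0 by (simp add: \<mu>_def k)
  qed
  then have "curve_vec r c (\<theta> ^ ?Q) = \<mu> *s ?v"
    by (simp add: vec_eq_iff)
  then have "(\<Sum>i\<le>r. ((\<theta> ^ ?Q) ^ i - \<mu> * \<theta> ^ i) *s c i) = 0"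
    by (simp add: curve_vec_def vec.scale_left_diff_distrib sum_subtractf vec.scale_sum_right)
  from frame_coeffs[OF c this] have eq: "(\<theta> ^ ?Q) ^ i = \<mu> * \<theta> ^ i" if "i \<le> r" for i
    using that by simp
  have "1 \<le> r" using c by (simp add: nrc_frame_def)
  then show ?thesis
    using eq[of 0] eq[of 1] by (simp add: GF_def)
qed

lemma set_meet_pts_over:
  fixes c :: "nat \<Rightarrow> 'k::alg_closed_field ^ 7"
  assumes q: "q = CHAR('k) ^ m" "0 < CHAR('k)"
    and c: "nrc_frame q r c"
    and nz: "\<not> curve q 1 r c \<subseteq> hyp q 1 h"
  shows "set_mset (meet_pts_over q d r h c) = curve q d r c \<inter> hyp q d h"
proof -
  let ?f = "curve_poly r h c"
  have f0: "?f \<noteq> 0"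
  proof
    assume f: "?f = 0"
    have "lin_form h (c r) = 0"
      using coeff_curve_poly[of r r h c] f by simp
    then have "\<forall>x\<in>P. lin_form h x = 0" if "P \<in> curve q 1 r c" for P
      using that pt_subset_lin_form[of "curve_vec r c _" h] pt_subset_lin_form[of "c r" h]
      by (auto simp only: curve_def lin_form_curve_vec f poly_0 Un_iff image_iff singleton_iff)
    then have "curve q 1 r c \<subseteq> hyp q 1 h"
      using curve_subset_PG[OF q c, of 1] unfolding hyp_def by blast
    with nz show False by blast
  qed
  have hyp_eq: "pt v \<in> hyp q d h \<longleftrightarrow> pt v \<in> PG q d \<and> lin_form h v = 0" for v
    by (simp only: hyp_def mem_Collect_eq pt_subset_lin_form)
  have last: "degree ?f < r \<longleftrightarrow> lin_form h (c r) = 0"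
  proof -
    have "degree ?f < r \<longleftrightarrow> coeff ?f r = 0"
      using degree_curve_poly[of r h c] f0 coeff_eq_0[of ?f r] leading_coeff_0_iff[of ?f]
      by (metis le_neq_implies_less)
    then show ?thesis by (simp add: coeff_curve_poly)
  qed
  have "set_mset (meet_pts_over q d r h c) =
      {P \<in> PG q d. (\<exists>\<theta>. poly ?f \<theta> = 0 \<and> P = pt (curve_vec r c \<theta>)) \<or>
                   (lin_form h (c r) = 0 \<and> P = pt (c r))}"
    using f0 last by (auto simp: meet_pts_over_def meet_pts_def split: if_splits)
  also have "\<dots> = curve q d r c \<inter> hyp q d h"
    using curve_subset_PG[OF q c, of d] curve_param_rational[OF q c]
    by (auto simp add: curve_def hyp_eq lin_form_curve_vec)
  finally show ?thesis .
qed

end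

theory Submission
  imports Defs
begin

text \<open>
  Write \<open>\<Sigma>\<^sub>\<infinity>\<close> as the direct sum \<open>V 0 \<oplus> V 1 \<oplus> V 2\<close> of the two-dimensional subspaces of
  \<open>'k ^ 7\<close> spanned by the transversal lines; the weight of a point is the number of its nonzero
  components. The multiset \<open>M\<close> of points at infinity of the curve is invariant under Frobenius,
  and so is the weight, so an orbit in \<open>M\<close> contributes \<open>w(P) o(P) = 3 s(P) \<in> {3, 6}\<close> to the
  total weight 6. Hence \<open>M\<close> is one orbit with \<open>(w, o)\<close> among (1,6), (2,3), (3,2), or the sum of
  two orbits with \<open>(w, o)\<close> among (1,3), (3,1). Rotating an orbit by Frobenius moves its
  components to the transversal lines named in the statement.
\<close>

subsection \<open>Points and hyperplanes\<close>

text \<open>The definitions speak of points over \<open>GF q 3\<close> and \<open>GF q 6\<close>,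
  while the linear algebra is done over the whole field \<open>'k\<close>. Two facts join the
  levels: a point lies in \<open>PG q d\<close> exactly when the \<open>d\<close>-th power of
  Frobenius fixes it, and an invariant subspace is spanned by its rational vectors. Hence the
  spanning condition on \<open>g\<close>, imposed only on points over \<open>GF q 3\<close>, already
  gives a direct sum over \<open>'k\<close>. Invariance is needed for the multiset of points at
  infinity, not merely for its support, because the hyperplane may meet the curve with multiplicity.
  Orbit counting leaves two conditions of the statement open. The condition
  \<open>X \<noteq> Y\<close> in dimension 3 comes from the spread: \<open>X = Y\<close> would put
  the point in an extended spread plane, where goodness would read 2 * 3 = 3 * 1. The condition that
  \<open>T\<close> avoids the plane of the three conjugates comes from the curve: points with at
  most \<open>r + 1\<close> distinct parameters are in general position.\<close>

lemma card_funpow_orbit: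
  assumes n: "0 < n" "(f ^^ n) x = x"
  defines "d \<equiv> card (range (\<lambda>i. (f ^^ i) x))"
  shows "0 < d" "(f ^^ d) x = x" "inj_on (\<lambda>i. (f ^^ i) x) {..<d}"
    "range (\<lambda>i. (f ^^ i) x) = (\<lambda>i. (f ^^ i) x) ` {..<d}"
proof -
  \<comment> \<open>\<open>e\<close> is the least period. Reduction modulo \<open>e\<close> shows
    that the first \<open>e\<close> iterates exhaust the orbit, and minimality that they are
    distinct, so \<open>e\<close> equals the cardinality \<open>d\<close>.\<close>
  define e where "e = (LEAST k. 0 < k \<and> (f ^^ k) x = x)"
  have e: "0 < e" "(f ^^ e) x = x"
    unfolding e_def using LeastI[of "\<lambda>k. 0 < k \<and> (f ^^ k) x = x" n] n by auto
  have least: "e \<le> k" if "0 < k" "(f ^^ k) x = x" for k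
    unfolding e_def using that by (simp add: Least_le)
  have modulo: "(f ^^ (i mod e)) x = (f ^^ i) x" for i
    by (rule funpow_mod_eq[OF e(2)])
  have ran: "range (\<lambda>i. (f ^^ i) x) = (\<lambda>i. (f ^^ i) x) ` {..<e}"
  proof -
    have "(f ^^ i) x \<in> (\<lambda>i. (f ^^ i) x) ` {..<e}" for i
      using e(1) by (intro image_eqI[where x = "i mod e"]) (simp_all add: modulo)
    then show ?thesis by blast
  qed
  have neq: "(f ^^ i) x \<noteq> (f ^^ j) x" if "i < j" "j < e" for i j
  proof
    assume eq: "(f ^^ i) x = (f ^^ j) x"
    \<comment> \<open>No injectivity of \<open>f\<close> is required: \<open>e - j\<close> further
      steps close the cycle and turn a coincidence into a period \<open>e - j + i\<close>, smaller
      than \<open>e\<close>.\<close>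
    have "(f ^^ (e - j + i)) x = (f ^^ (e - j)) ((f ^^ j) x)"
      using eq by (simp add: funpow_add)
    also have "\<dots> = (f ^^ (e - j + j)) x"
      unfolding funpow_add comp_apply ..
    also have "\<dots> = x" using that e by simp
    finally have "e \<le> e - j + i" using that by (intro least) simp_all
    then show False using that by simp
  qed
  have inj: "inj_on (\<lambda>i. (f ^^ i) x) {..<e}"
    unfolding inj_on_def using neq by (metis lessThan_iff linorder_neqE_nat)
  have "d = e"
    unfolding d_def ran using card_image[OF inj] by simp
  then show "0 < d" "(f ^^ d) x = x" "inj_on (\<lambda>i. (f ^^ i) x) {..<d}"
    "range (\<lambda>i. (f ^^ i) x) = (\<lambda>i. (f ^^ i) x) ` {..<d}"
    using e inj ran by simp_all
qed

lemma mem_pt: "v \<in> pt v"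
  by (simp add: pt_def vec.span_base)

lemma pt_subset_span_iff: "pt v \<subseteq> vec.span S \<longleftrightarrow> v \<in> vec.span S"
  unfolding pt_def by (simp add: vec.span_minimal vec.span_base subset_iff)
    (meson insertI1 vec.span_base vec.span_minimal vec.subspace_span empty_subsetI insert_subset subsetD)

lemma pt_eq_iff:
  assumes "v \<noteq> 0"
  shows "pt v = pt w \<longleftrightarrow> (\<exists>a. a \<noteq> 0 \<and> v = a *s w)"
proof
  assume "pt v = pt w"
  then have "v \<in> vec.span {w}" using vec.span_base[of v "{v}"] by (simp add: pt_def)
  then show "\<exists>a. a \<noteq> 0 \<and> v = a *s w" using assms by (auto simp: vec.span_singleton)
next
  assume "\<exists>a. a \<noteq> 0 \<and> v = a *s w"
  then obtain a where a: "a \<noteq> 0" "v = a *s w" by blast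
  have "v \<in> vec.span {w}" using a by (auto simp: vec.span_singleton)
  moreover have "w = inverse a *s v" using a by simp
  then have "w \<in> vec.span {v}" by (auto simp: vec.span_singleton)
  ultimately show "pt v = pt w"
    unfolding pt_def by (intro equalityI vec.span_minimal) auto
qed

lemma lin_form_add: "lin_form h (v + w) = lin_form h v + lin_form h w"
  by (simp add: lin_form_def algebra_simps sum.distrib)

lemma lin_form_scale: "lin_form h (a *s v) = a * lin_form h v"
  by (simp add: lin_form_def sum_distrib_left mult.left_commute)

lemma subspace_ker_lin_form: "vec.subspace {v. lin_form h v = 0}"
  by (auto simp: vec.subspace_def lin_form_add lin_form_scale) (simp add: lin_form_def)

text \<open>Adding a basis vector on which the form is nonzero fills the 7-dimensional space, and
  one vector raises the dimension by at most 1.\<close>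

lemma dim_ker_lin_form:
  fixes h :: "'k::field ^ 7"
  assumes "h \<noteq> 0"
  shows "6 \<le> vec.dim {v. lin_form h v = 0}"
proof -
  obtain j where j: "h $ j \<noteq> 0" using assms by (auto simp: vec_eq_iff)
  let ?K = "{v. lin_form h v = 0}" and ?e = "axis j (1 :: 'k)"
  have e: "lin_form h ?e = h $ j"
    by (simp add: lin_form_def axis_def if_distrib cong: if_cong)
  have "v \<in> vec.span (insert ?e ?K)" for v
  proof -
    let ?a = "lin_form h v / h $ j"
    have "lin_form h (v - ?a *s ?e) = 0"
      using j lin_form_add[of h "v - ?a *s ?e" "?a *s ?e"] by (simp add: lin_form_scale e)
    then show ?thesis
      unfolding vec.span_breakdown_eq by (auto intro: vec.span_base)
  qed
  then have "vec.span (insert ?e ?K) = UNIV" by blast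
  then have "vec.dim (insert ?e ?K) = 7"
    using vec.dim_span[of "insert ?e ?K"] vec_dim_card[where 'a = 'k and 'n = 7]
    by simp
  then show ?thesis
    using vec.dim_insert[of ?e ?K] by (simp split: if_splits)
qed

lemma pt_scale: "k \<noteq> 0 \<Longrightarrow> pt (k *s v) = pt v"
  by (cases "v = 0") (auto simp: pt_eq_iff[of "k *s v" v])

lemma pt_mem_hyp_iff: "pt v \<in> hyp q d h \<longleftrightarrow> pt v \<in> PG q d \<and> lin_form h v = 0"
  unfolding hyp_def mem_Collect_eq pt_subset_lin_form ..

subsection \<open>Points of a normal rational curve are in general position\<close>

lemma poly_eq_sum_atMost:
  fixes F :: "'a::comm_semiring_1 poly"
  assumes "degree F \<le> r"
  shows "poly F x = (\<Sum>i\<le>r. coeff F i * x ^ i)"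
proof -
  have "poly F x = (\<Sum>i\<le>degree F. coeff F i * x ^ i)" by (rule poly_altdef)
  also have "\<dots> = (\<Sum>i\<le>r. coeff F i * x ^ i)"
    using assms by (intro sum.mono_neutral_left) (auto simp: coeff_eq_0)
  finally show ?thesis .
qed

text \<open>A polynomial \<open>F\<close> of degree at most \<open>r\<close> acts as a linear
  functional on the span of the frame, sending \<open>c i\<close> to \<open>coeff F i\<close>. Its
  value at \<open>curve_vec r c \<theta>\<close> is \<open>poly F \<theta>\<close>, so if
  \<open>F\<close> vanishes on \<open>\<Theta>\<close>, the functional kills the span of those curve
  points.\<close>

lemma curve_span_coeffs:
  assumes c: "nrc_frame q r c" and z: "(\<Sum>i\<le>r. a i *s c i) \<in> vec.span (curve_vec r c ` \<Theta>)"
    and F: "degree F \<le> r" "\<And>\<theta>. \<theta> \<in> \<Theta> \<Longrightarrow> poly F \<theta> = 0"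
  shows "(\<Sum>i\<le>r. a i * coeff F i) = 0"
proof -
  have "\<exists>b. z = (\<Sum>i\<le>r. b i *s c i) \<and> (\<Sum>i\<le>r. b i * coeff F i) = 0"
    if "z \<in> vec.span (curve_vec r c ` \<Theta>)" for z
    using that
  proof (induction rule: vec.span_induct_alt)
    case base
    show ?case by (intro exI[of _ "\<lambda>_. 0"]) simp
  next
    case (step k x y)
    then obtain \<theta> b where \<theta>: "\<theta> \<in> \<Theta>" "x = curve_vec r c \<theta>"
      and b: "y = (\<Sum>i\<le>r. b i *s c i)" "(\<Sum>i\<le>r. b i * coeff F i) = 0"
      by blast
    have "poly F \<theta> = (\<Sum>i\<le>r. coeff F i * \<theta> ^ i)"
      using F(1) by (rule poly_eq_sum_atMost)
    then have "(\<Sum>i\<le>r. \<theta> ^ i * coeff F i) = 0"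
      using F(2)[OF \<theta>(1)] by (simp add: mult.commute)
    then have "(\<Sum>i\<le>r. (k * \<theta> ^ i + b i) * coeff F i) = 0"
      using b(2) by (simp add: distrib_right sum.distrib mult.assoc flip: sum_distrib_left)
    moreover have "k *s x + y = (\<Sum>i\<le>r. (k * \<theta> ^ i + b i) *s c i)"
      by (simp add: \<theta> b curve_vec_def vec.scale_sum_right vec.scale_left_distrib sum.distrib)
    ultimately show ?case by (intro exI[of _ "\<lambda>i. k * \<theta> ^ i + b i"] conjI)
  qed
  then obtain b where b: "(\<Sum>i\<le>r. a i *s c i) = (\<Sum>i\<le>r. b i *s c i)" "(\<Sum>i\<le>r. b i * coeff F i) = 0"
    using z by blast
  have "(\<Sum>i\<le>r. (a i - b i) *s c i) = 0"
    using b(1) by (simp add: vec.scale_left_diff_distrib sum_subtractf)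
  then have "a i = b i" if "i \<le> r" for i using frame_coeffs[OF c, of "\<lambda>i. a i - b i" i] that by simp
  then show ?thesis using b(2) by simp
qed

lemma poly_root_prod:
  fixes \<Theta> :: "'k::field set"
  assumes "finite \<Theta>"
  shows "degree (\<Prod>\<theta>\<in>\<Theta>. [:-\<theta>, 1:]) = card \<Theta>" "lead_coeff (\<Prod>\<theta>\<in>\<Theta>. [:-\<theta>, 1:]) = 1"
proof -
  show "degree (\<Prod>\<theta>\<in>\<Theta>. [:-\<theta>, 1:]) = card \<Theta>" by (simp add: degree_prod_eq_sum_degree)
  show "lead_coeff (\<Prod>\<theta>\<in>\<Theta>. [:-\<theta>, 1:]) = 1" unfolding lead_coeff_prod by simp
qed

text \<open>The functional of the monic polynomial with root set \<open>\<Theta>\<close> kills the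
  span, and its value at parameter \<open>t\<close> is the product of the differences
  \<open>t - \<theta>\<close>. The bound on \<open>card \<Theta>\<close> keeps the degree within
  \<open>r\<close>.\<close>

lemma curve_vec_in_span:
  fixes \<Theta> :: "'k::field set"
  assumes "nrc_frame q r c" "finite \<Theta>" "card \<Theta> \<le> r"
    and "curve_vec r c t \<in> vec.span (curve_vec r c ` \<Theta>)"
  shows "t \<in> \<Theta>"
proof -
  let ?F = "\<Prod>\<theta>\<in>\<Theta>. [:-\<theta>, 1:]"
  have deg: "degree ?F \<le> r" using assms poly_root_prod[OF assms(2)] by simp
  have "(\<Sum>i\<le>r. t ^ i * coeff ?F i) = 0"
    using assms deg
    by (intro curve_span_coeffs[OF assms(1), of _ \<Theta>]) (auto simp: curve_vec_def poly_prod)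
  then have "poly ?F t = 0"
    using poly_eq_sum_atMost[OF deg] by (simp add: mult.commute)
  then show ?thesis using assms(2) by (auto simp: poly_prod)
qed

lemma frame_last_notin_span:
  fixes \<Theta> :: "'k::field set"
  assumes "nrc_frame q r c" "finite \<Theta>" "card \<Theta> \<le> r"
  shows "c r \<notin> vec.span (curve_vec r c ` \<Theta>)"
proof
  assume *: "c r \<in> vec.span (curve_vec r c ` \<Theta>)"
  let ?F = "\<Prod>\<theta>\<in>\<Theta>. [:-\<theta>, 1:]" and ?a = "\<lambda>i. if i = r then 1 else 0 :: 'k"
  \<comment> \<open>At the parameter at infinity the functional reads the coefficient of degree
    \<open>r\<close>. The monomial factor raises the degree to exactly \<open>r\<close> and keeps
    the roots in \<open>\<Theta>\<close>.\<close>
  let ?G = "monom 1 (r - card \<Theta>) * ?F"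
  have "coeff ?G r = 1"
    using assms poly_root_prod[OF assms(2)] by (simp add: coeff_monom_mult)
  have deg: "degree ?G \<le> r"
    using degree_mult_le[of "monom 1 (r - card \<Theta>)" ?F] assms poly_root_prod(1)[OF assms(2)]
      degree_monom_le[of "1 :: 'k" "r - card \<Theta>"] by simp
  have "(\<Sum>i\<le>r. ?a i *s c i) = c r"
    by (simp add: if_distrib[of "\<lambda>x. x *s _"] cong: if_cong)
  then have "(\<Sum>i\<le>r. ?a i * coeff ?G i) = 0"
    using * assms deg by (intro curve_span_coeffs[OF assms(1), of _ \<Theta>]) (auto simp: poly_prod)
  also have "(\<Sum>i\<le>r. ?a i * coeff ?G i) = coeff ?G r"
    by (simp add: if_distrib[of "\<lambda>x. x * _"] cong: if_cong)
  finally show False using \<open>coeff ?G r = 1\<close> by simp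
qed

lemma proots_linear_factors: "proots (\<Prod>x\<in>#A. [:-x, 1:]) = (A :: 'k::field multiset)"
proof (induction A)
  case (add x A)
  have "(\<Prod>y\<in>#A. [:-y, 1:]) \<noteq> 0" by (auto simp: prod_mset_zero_iff)
  then show ?case using add by (simp add: proots_mult del: mult_pCons_left)
qed simp

lemma meet_pts_cases:
  assumes "P \<in># meet_pts r h c"
  obtains t where "P = pt (curve_vec r c t)" | "P = pt (c r)"
  using assms by (auto simp: meet_pts_def split: if_splits)

lemma rational_meet_pt_notin_span:
  fixes c :: "nat \<Rightarrow> 'k::field ^ 7"
  assumes c: "nrc_frame q r c" and r: "3 \<le> r"
    and T: "T \<in># meet_pts r h c" "T \<in> PG q 1"
    and P: "set [P1, P2, P3] \<subseteq> set_mset (meet_pts r h c) - PG q 1"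
  shows "T \<notin> pg_span q d {P1, P2, P3}"
proof
  assume span: "T \<in> pg_span q d {P1, P2, P3}"
  \<comment> \<open>The point at infinity of the parametrization is rational, so the three
    irrational points all have finite parameters.\<close>
  have "rational_vec q 1 (c r)" using c by (simp add: nrc_frame_def)
  then have last: "pt (c r) \<in> PG q 1" using frame_last_nonzero[OF c] by (auto simp: PG_def)
  have "\<exists>\<theta>. X = pt (curve_vec r c \<theta>)" if "X \<in> {P1, P2, P3}" for X
  proof -
    have "X \<in># meet_pts r h c" "X \<noteq> pt (c r)" using that P last by auto
    then show ?thesis by (auto elim: meet_pts_cases)
  qed
  from this[of P1] this[of P2] this[of P3] obtain \<theta>1 \<theta>2 \<theta>3
    where \<theta>: "P1 = pt (curve_vec r c \<theta>1)" "P2 = pt (curve_vec r c \<theta>2)"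
      "P3 = pt (curve_vec r c \<theta>3)" by auto
  let ?\<Theta> = "{\<theta>1, \<theta>2, \<theta>3}"
  have "vec.span (\<Union>{P1, P2, P3}) \<subseteq> vec.span (curve_vec r c ` ?\<Theta>)"
  proof (rule vec.span_minimal)
    have "pt (curve_vec r c \<theta>) \<subseteq> vec.span (curve_vec r c ` ?\<Theta>)" if "\<theta> \<in> ?\<Theta>" for \<theta>
      unfolding pt_subset_span_iff using that by (intro vec.span_base imageI)
    then show "\<Union>{P1, P2, P3} \<subseteq> vec.span (curve_vec r c ` ?\<Theta>)"
      unfolding \<theta> by simp
  qed simp
  then have T_span: "T \<subseteq> vec.span (curve_vec r c ` ?\<Theta>)" using span by (auto simp: pg_span_def)
  have card: "card ?\<Theta> \<le> r"
    using r card_insert_le_m1[of 3 "{\<theta>2, \<theta>3}" \<theta>1] card_insert_le_m1[of 2 "{\<theta>3}" \<theta>2] by simp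
  from T(1) show False
  proof (cases rule: meet_pts_cases)
    case (1 t)
    then have "t \<in> ?\<Theta>"
      using T_span curve_vec_in_span[OF c _ card] by (simp add: pt_subset_span_iff)
    then have "T \<in> {P1, P2, P3}" using 1 \<theta> by auto
    then show False using P T(2) by auto
  next
    case 2
    then show False
      using T_span frame_last_notin_span[OF c _ card] by (simp add: pt_subset_span_iff)
  qed
qed

subsection \<open>The Frobenius collineation and Galois descent\<close>

text \<open>\<open>\<phi>\<close> is the semilinear map on vectors beneath the collineation
  \<open>frob q\<close> on points. Arguments about subspaces use \<open>\<phi>\<close>, those about
  orbits use \<open>frob q\<close>.\<close>

locale frobenius =
  fixes q m :: nat and \<phi> :: "'k::alg_closed_field ^ 7 \<Rightarrow> 'k ^ 7"
  assumes q: "q = CHAR('k) ^ m" and char_pos: "0 < CHAR('k)" and m_pos: "0 < m"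
    and phi: "\<phi> = (\<lambda>v. \<chi> i. (v $ i) ^ q)"
begin

lemma q_gt_1: "1 < q"
  unfolding q using prime_gt_1_nat[OF prime_CHAR_semidom[OF char_pos]] m_pos
  by (intro one_less_power)

lemma power_q_add: "(x + y :: 'k) ^ (q ^ d) = x ^ (q ^ d) + y ^ (q ^ d)"
  unfolding q power_mult[symmetric]
  by (rule freshmans_dream'[OF prime_CHAR_semidom[OF char_pos] refl])

lemma power_q_inj: "(x :: 'k) ^ (q ^ d) = y ^ (q ^ d) \<Longrightarrow> x = y"
  using power_q_add[of "x - y" y d] q_gt_1 by (simp add: power_eq_0_iff)

lemma ex_power_q: "\<exists>y :: 'k. y ^ (q ^ d) = x"
  using nth_root_exists[of "q ^ d" x] q_gt_1 by auto

lemma artin_schreier: "\<exists>b :: 'k. b ^ (q ^ d) - b = a" if "0 < d"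
proof -
  have Q: "1 < q ^ d" using q_gt_1 that by (intro one_less_power)
  let ?p = "monom 1 (q ^ d) - [:a, 1:] :: 'k poly"
  \<comment> \<open>As \<open>q ^ d\<close> exceeds 1, the top term is clear of the linear part; the
    polynomial is not constant and has a root.\<close>
  have "coeff ?p (q ^ d) = 1"
    using Q q_gt_1 that by (simp add: coeff_pCons split: nat.splits)
  then have "degree ?p > 0"
    using Q le_degree[of ?p "q ^ d"] by simp
  then obtain b where "poly ?p b = 0"
    using alg_closed_imp_poly_has_root by blast
  then have "b ^ (q ^ d) - b = a"
    by (simp add: poly_monom algebra_simps)
  then show ?thesis ..
qed

lemma phi_funpow: "(\<phi> ^^ d) v = (\<chi> i. (v $ i) ^ (q ^ d))"
  by (induction d) (simp_all add: phi vec_eq_iff power_mult[symmetric] mult.commute)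

lemma phi_funpow_add: "(\<phi> ^^ d) (v + w) = (\<phi> ^^ d) v + (\<phi> ^^ d) w"
  by (simp add: phi_funpow vec_eq_iff power_q_add)

lemma phi_funpow_scale: "(\<phi> ^^ d) (a *s v) = a ^ (q ^ d) *s (\<phi> ^^ d) v"
  by (simp add: phi_funpow vec_eq_iff power_mult_distrib)

lemmas phi_add = phi_funpow_add[of 1, simplified]
  and phi_scale = phi_funpow_scale[of 1, simplified]

lemma phi_funpow_0 [simp]: "(\<phi> ^^ d) 0 = 0"
  using q_gt_1 by (simp add: phi_funpow vec_eq_iff power_0_left)

lemma phi_funpow_inj: "(\<phi> ^^ d) v = (\<phi> ^^ d) w \<Longrightarrow> v = w"
  by (auto simp: phi_funpow vec_eq_iff dest: power_q_inj)

lemma phi_0 [simp]: "\<phi> 0 = 0"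
  using phi_funpow_0[of 1] by simp

lemma phi_funpow_eq_0 [simp]: "(\<phi> ^^ d) v = 0 \<longleftrightarrow> v = 0"
  using phi_funpow_inj[of d v 0] by auto

lemma phi_eq_0 [simp]: "\<phi> v = 0 \<longleftrightarrow> v = 0"
  using phi_funpow_eq_0[of 1 v] by simp

lemma rational_iff: "rational_vec q d v \<longleftrightarrow> (\<phi> ^^ d) v = v"
  by (simp add: rational_vec_def GF_def phi_funpow vec_eq_iff)

lemma phi_span: "\<phi> ` vec.span S = vec.span (\<phi> ` S)"
proof
  show "\<phi> ` vec.span S \<subseteq> vec.span (\<phi> ` S)"
  proof (rule image_subsetI)
    fix v assume "v \<in> vec.span S"
    then show "\<phi> v \<in> vec.span (\<phi> ` S)"
      by (induction rule: vec.span_induct_alt)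
        (auto simp: phi_add phi_scale intro: vec.span_add vec.span_scale vec.span_base vec.span_zero)
  qed
  show "vec.span (\<phi> ` S) \<subseteq> \<phi> ` vec.span S"
  proof
    fix v assume "v \<in> vec.span (\<phi> ` S)"
    then show "v \<in> \<phi> ` vec.span S"
    proof (induction rule: vec.span_induct_alt)
      case base
      show ?case using vec.span_zero[of S] phi_0 by (metis imageI)
    next
      case (step a x y)
      obtain s t where s: "x = \<phi> s" "s \<in> S" and t: "y = \<phi> t" "t \<in> vec.span S"
        using step by blast
      \<comment> \<open>Pulling a scalar back through a semilinear map takes a \<open>q\<close>-th
        root, which exists in an algebraically closed field.\<close>
      obtain b where "b ^ q = a" using ex_power_q[of 1 a] by auto
      then have "a *s x + y = \<phi> (b *s s + t)"
        by (simp add: s t phi_add phi_scale)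
      then show ?case
        using s t by (auto intro!: imageI vec.span_add vec.span_scale intro: vec.span_base)
    qed
  qed
qed

lemma frob_image: "frob q P = \<phi> ` P"
  by (simp add: frob_def phi)

lemma frob_pt: "frob q (pt v) = pt (\<phi> v)"
  unfolding frob_image pt_def phi_span by simp

lemma frob_funpow_pt: "(frob q ^^ d) (pt v) = pt ((\<phi> ^^ d) v)"
  by (induction d) (simp_all add: frob_pt)

text \<open>Hilbert 90 for points: scaling one coordinate to 1 makes the representative rational.\<close>

lemma pt_in_PG_iff:
  fixes v :: "'k ^ 7"
  assumes "v \<noteq> 0"
  shows "pt v \<in> PG q d \<longleftrightarrow> (frob q ^^ d) (pt v) = pt v"
proof
  assume "pt v \<in> PG q d"
  then obtain w where "pt v = pt w" "rational_vec q d w" by (auto simp: PG_def)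
  then show "(frob q ^^ d) (pt v) = pt v" by (simp add: frob_funpow_pt rational_iff)
next
  assume "(frob q ^^ d) (pt v) = pt v"
  then obtain a where a: "(\<phi> ^^ d) v = a *s v"
    using pt_eq_iff[of "(\<phi> ^^ d) v" v] assms by (auto simp: frob_funpow_pt)
  obtain j where j: "v $ j \<noteq> 0" using assms by (auto simp: vec_eq_iff)
  have "(v $ j) ^ (q ^ d) = a * v $ j"
    using a by (simp add: phi_funpow vec_eq_iff)
  then have "inverse (v $ j) ^ (q ^ d) * a = inverse (v $ j)"
    using j by (simp add: power_inverse field_simps) (metis mult_eq_0_iff power_not_zero)
  then have "rational_vec q d (inverse (v $ j) *s v)"
    by (simp add: rational_iff phi_funpow_scale a vec.scale_scale)
  moreover have "pt v = pt (inverse (v $ j) *s v)"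
    using j assms by (subst pt_eq_iff) (auto intro!: exI[of _ "v $ j"])
  ultimately show "pt v \<in> PG q d"
    using j assms by (auto simp: PG_def)
qed

text \<open>
  Galois descent. In a counterexample take \<open>v\<close> with as few nonzero coordinates as possible,
  scaled so that one of them is 1. Then \<open>\<phi>\<^sup>d v - v\<close> has fewer, so it is \<open>\<phi>\<^sup>d u - u\<close> for some
  \<open>u\<close> in the span of the rational vectors (solve \<open>b ^ q\<^sup>d - b = a\<close> coefficientwise), and \<open>v - u\<close>
  is rational.
\<close>

lemma descent:
  assumes W: "vec.subspace W" and inv: "\<And>v. v \<in> W \<Longrightarrow> (\<phi> ^^ d) v \<in> W" and d: "0 < d"
    and v: "v \<in> W"
  shows "v \<in> vec.span {w \<in> W. rational_vec q d w}"
  using v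
proof (induction "card {i. v $ i \<noteq> 0}" arbitrary: v rule: less_induct)
  case less
  let ?R = "{w \<in> W. rational_vec q d w}"
  have lift: "\<exists>u \<in> vec.span ?R. (\<phi> ^^ d) u - u = x" if "x \<in> vec.span ?R" for x
    using that
  proof (induction rule: vec.span_induct_alt)
    case base
    show ?case by (intro bexI[of _ 0]) (auto simp: vec.span_zero)
  next
    case (step a x y)
    then obtain u where u: "u \<in> vec.span ?R" "(\<phi> ^^ d) u - u = y" by blast
    obtain b where b: "b ^ (q ^ d) - b = a" using artin_schreier[OF d] by blast
    have x: "(\<phi> ^^ d) x = x" using step by (simp add: rational_iff)
    have "(\<phi> ^^ d) (b *s x + u) - (b *s x + u) = (b ^ (q ^ d) - b) *s x + ((\<phi> ^^ d) u - u)"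
      unfolding phi_funpow_add phi_funpow_scale x
      by (simp add: vec.scale_left_diff_distrib)
    then show ?case
      using step u b
      by (intro bexI[of _ "b *s x + u"])
        (auto intro!: vec.span_add vec.span_scale intro: vec.span_base)
  qed
  show ?case
  proof (cases "v = 0")
    case True
    then show ?thesis by (simp add: vec.span_zero)
  next
    case False
    then obtain j where j: "v $ j \<noteq> 0" by (auto simp: vec_eq_iff)
    define w where "w = inverse (v $ j) *s v"
    have w: "w \<in> W" "w $ j = 1" "{i. w $ i \<noteq> 0} = {i. v $ i \<noteq> 0}"
      using j less.prems W by (auto simp: w_def vec.subspace_scale)
    let ?x = "(\<phi> ^^ d) w - w"
    have "{i. ?x $ i \<noteq> 0} \<subseteq> {i. v $ i \<noteq> 0} - {j}"
      using w q_gt_1 unfolding w(3)[symmetric] by (auto simp: phi_funpow power_0_left)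
    then have "card {i. ?x $ i \<noteq> 0} < card {i. v $ i \<noteq> 0}"
      using j by (intro psubset_card_mono) auto
    moreover have "?x \<in> W"
      using inv[OF w(1)] w(1) W by (simp add: vec.subspace_diff)
    ultimately have "?x \<in> vec.span ?R" by (rule less.hyps)
    then obtain u where u: "u \<in> vec.span ?R" "(\<phi> ^^ d) u - u = ?x"
      using lift by blast
    have "(\<phi> ^^ d) (w - u) + (\<phi> ^^ d) u = (\<phi> ^^ d) w"
      by (simp flip: phi_funpow_add)
    moreover have "(\<phi> ^^ d) w - (\<phi> ^^ d) u = w - u"
      using u(2) by (simp add: algebra_simps)
    ultimately have "rational_vec q d (w - u)"
      unfolding rational_iff by (metis add_diff_cancel)
    moreover have "u \<in> W"
      using u(1) vec.span_minimal[of ?R W] W by blast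
    ultimately have "w - u \<in> ?R"
      using w(1) W by (simp add: vec.subspace_diff)
    then have "(w - u) + u \<in> vec.span ?R"
      using u(1) by (intro vec.span_add) (auto intro: vec.span_base)
    then have "(v $ j) *s w \<in> vec.span ?R"
      by (simp add: vec.span_scale)
    then show ?thesis using j by (simp add: w_def vec.scale_scale)
  qed
qed

section \<open>Frobenius on subspaces, linear forms and the points at infinity\<close>

lemma frob_funpow_image: "(frob q ^^ d) P = (\<phi> ^^ d) ` P"
  by (induction d) (auto simp: frob_image)

lemma phi_funpow_span: "(\<phi> ^^ d) ` vec.span S = vec.span ((\<phi> ^^ d) ` S)"
proof (induction d)
  case (Suc d)
  have "(\<phi> ^^ Suc d) ` vec.span S = \<phi> ` (\<phi> ^^ d) ` vec.span S"
    by (simp add: image_comp)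
  also have "\<dots> = vec.span ((\<phi> ^^ Suc d) ` S)"
    unfolding Suc.IH phi_span by (simp add: image_comp)
  finally show ?case .
qed simp

lemma lin_form_phi_funpow:
  assumes "rational_vec q 1 h"
  shows "lin_form h ((\<phi> ^^ d) v) = lin_form h v ^ (q ^ d)"
proof -
  have "h $ i ^ (q ^ d) = h $ i" for i
    using assms GF_power[of "h $ i" q d] by (simp add: rational_vec_def GF_def)
  then show ?thesis
    by (simp add: lin_form_def power_q_sum[OF q char_pos] phi_funpow power_mult_distrib)
qed

lemma PG_mono_dvd:
  fixes P :: "('k ^ 7) set"
  assumes "P \<in> PG q d" "d dvd e"
  shows "P \<in> PG q e"
proof -
  obtain v where v: "P = pt v" "v \<noteq> 0" using assms(1) by (auto simp: PG_def)
  obtain n where n: "e = d * n" using assms(2) by blast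
  have "(frob q ^^ d) P = P" using assms(1) v(1) pt_in_PG_iff[OF v(2)] by simp
  then have "((frob q ^^ d) ^^ n) P = P" by (induction n) simp_all
  then show ?thesis using v pt_in_PG_iff by (simp add: n funpow_mult)
qed

text \<open>Raising coefficients to the power \<open>q\<close> is multiplicative on polynomials,
  fixes \<open>f\<close>, and turns each factor \<open>[:- x, 1:]\<close> into
  \<open>[:- (x ^ q), 1:]\<close>. Comparing the two factorizations of \<open>f\<close> compares
  roots with multiplicity.\<close>

lemma proots_frobenius:
  fixes f :: "'k poly"
  assumes f: "\<And>n. coeff f n ^ q = coeff f n"
  shows "image_mset (\<lambda>x. x ^ q) (proots f) = proots f"
proof (cases "f = 0")
  case False
  then obtain A where A: "f = smult (lead_coeff f) (\<Prod>x\<in>#A. [:-x, 1:])"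
    using alg_closed_imp_factorization by blast
  define F :: "'k poly \<Rightarrow> 'k poly" where "F = map_poly (\<lambda>x. x ^ q)"
  have coeff_F: "coeff (F p) n = coeff p n ^ q" for p n
    using q_gt_1 by (simp add: F_def coeff_map_poly power_0_left)
  have F_mult: "F (p * p') = F p * F p'" for p p'
    using power_q_sum[OF q char_pos, where d = 1]
    by (intro poly_eqI) (simp add: coeff_F coeff_mult flip: power_mult_distrib)
  \<comment> \<open>The sign follows from additivity, so even and odd characteristic are treated
    alike.\<close>
  have "(- x) ^ q + x ^ q = 0" for x :: 'k
    using power_q_add[of "- x" x 1] q_gt_1 by (simp add: power_0_left)
  then have neg: "(- x) ^ q = - (x ^ q)" for x :: 'k
    by (simp add: eq_neg_iff_add_eq_0)
  have F_linear: "F [:- x, 1:] = [:- (x ^ q), 1:]" for x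
    using q_gt_1 by (intro poly_eqI) (auto simp: coeff_F coeff_pCons neg power_0_left split: nat.splits)
  have F_prod: "F (\<Prod>x\<in>#B. [:-x, 1:]) = (\<Prod>x\<in>#image_mset (\<lambda>x. x ^ q) B. [:-x, 1:])" for B
  proof (induction B)
    case empty
    show ?case using q_gt_1 by (intro poly_eqI) (simp add: coeff_F power_0_left)
  next
    case (add x B)
    then show ?case by (simp add: F_mult F_linear del: mult_pCons_left)
  qed
  have "f = F f" by (intro poly_eqI) (simp add: coeff_F f)
  also have "\<dots> = F ([:lead_coeff f:] * (\<Prod>x\<in>#A. [:-x, 1:]))"
    by (subst A) simp
  also have "\<dots> = [:lead_coeff f:] * F (\<Prod>x\<in>#A. [:-x, 1:])"
  proof -
    have "F [:lead_coeff f:] = [:lead_coeff f:]"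
      using q_gt_1 by (intro poly_eqI) (auto simp: coeff_F coeff_pCons f power_0_left split: nat.splits)
    then show ?thesis by (simp only: F_mult)
  qed
  finally have "f = smult (lead_coeff f) (\<Prod>x\<in>#image_mset (\<lambda>x. x ^ q) A. [:-x, 1:])"
    by (simp add: F_prod)
  then have "proots f = proots (\<Prod>x\<in>#image_mset (\<lambda>x. x ^ q) A. [:-x, 1:])"
    using False by (metis leading_coeff_0_iff proots_smult)
  then have "proots f = image_mset (\<lambda>x. x ^ q) A" by (simp only: proots_linear_factors)
  moreover have "proots f = proots (\<Prod>x\<in>#A. [:-x, 1:])"
    using A False by (metis leading_coeff_0_iff proots_smult)
  then have "proots f = A" by (simp only: proots_linear_factors)
  ultimately show ?thesis by simp
qed simp

text \<open>The form and the frame are rational, so \<open>curve_poly\<close> has coefficients in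
  \<open>GF q 1\<close>, Frobenius moves the point with parameter \<open>\<theta>\<close> to the one
  with parameter \<open>\<theta> ^ q\<close>, and \<open>pt (c r)\<close> stays fixed together with
  its multiplicity.\<close>

lemma frob_meet_pts:
  assumes c: "nrc_frame q r c" and h: "rational_vec q 1 h"
  shows "image_mset (frob q) (meet_pts r h c) = meet_pts r h (c :: nat \<Rightarrow> 'k ^ 7)"
proof -
  let ?f = "curve_poly r h c"
  have c_rat: "\<phi> (c i) = c i" if "i \<le> r" for i
    using c that rational_iff[of 1 "c i"] by (simp add: nrc_frame_def)
  have "coeff ?f n ^ q = coeff ?f n" for n
  proof (cases "n \<le> r")
    case True
    then show ?thesis
      using lin_form_phi_funpow[OF h, of 1 "c n"] by (simp add: coeff_curve_poly c_rat)
  next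
    case False
    then have "coeff ?f n = 0" using degree_curve_poly[of r h c] by (intro coeff_eq_0) simp
    then show ?thesis using q_gt_1 by (simp add: power_0_left)
  qed
  then have roots: "image_mset (\<lambda>x. x ^ q) (proots ?f) = proots ?f" by (rule proots_frobenius)
  have "\<phi> (curve_vec r c \<theta>) = curve_vec r c (\<theta> ^ q)" for \<theta>
    using power_q_curve_vec[OF q char_pos c, of \<theta> _ 1] by (simp add: phi vec_eq_iff)
  then have "image_mset (frob q) (image_mset (\<lambda>\<theta>. pt (curve_vec r c \<theta>)) (proots ?f)) =
      image_mset (\<lambda>\<theta>. pt (curve_vec r c \<theta>)) (image_mset (\<lambda>x. x ^ q) (proots ?f))"
    by (simp add: multiset.map_comp comp_def frob_pt)
  then show ?thesis
    unfolding meet_pts_def roots by (simp add: frob_pt c_rat)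
qed

section \<open>Orbits of points under Frobenius\<close>

lemma frob_funpow_pt_in_PG_iff:
  fixes v :: "'k ^ 7"
  assumes "v \<noteq> 0"
  shows "(frob q ^^ i) (pt v) \<in> PG q d \<longleftrightarrow> pt v \<in> PG q d"
proof -
  define P where "P = pt v"
  have v: "P = pt v" "v \<noteq> 0" using assms by (simp_all add: P_def)
  have inj: "inj (frob q ^^ i :: ('k ^ 7) set \<Rightarrow> _)"
    using phi_funpow_inj by (auto simp: inj_on_def frob_funpow_image inj_image_eq_iff)
  have "(frob q ^^ i) P \<in> PG q d \<longleftrightarrow> (frob q ^^ d) ((frob q ^^ i) P) = (frob q ^^ i) P"
    using v pt_in_PG_iff[of "(\<phi> ^^ i) v" d] by (simp add: frob_funpow_pt)
  moreover have "(frob q ^^ d) ((frob q ^^ i) P) = (frob q ^^ i) ((frob q ^^ d) P)"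
    by (metis add.commute comp_apply funpow_add)
  moreover have "(frob q ^^ i) ((frob q ^^ d) P) = (frob q ^^ i) P \<longleftrightarrow> (frob q ^^ d) P = P"
    using inj by (auto dest: injD)
  moreover have "P \<in> PG q d \<longleftrightarrow> (frob q ^^ d) P = P" using v pt_in_PG_iff[of v d] by simp
  ultimately show ?thesis by (simp add: P_def)
qed

lemma frob_funpow_in_PG_iff:
  fixes P :: "('k ^ 7) set"
  assumes "P \<in> PG q e"
  shows "(frob q ^^ i) P \<in> PG q d \<longleftrightarrow> P \<in> PG q d"
proof -
  obtain v where "P = pt v" "v \<noteq> 0" using assms by (auto simp: PG_def)
  then show ?thesis using frob_funpow_pt_in_PG_iff by simp
qed

lemma PG_fixed:
  fixes P :: "('k ^ 7) set"
  assumes "P \<in> PG q d"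
  shows "(frob q ^^ d) P = P"
  using assms pt_in_PG_iff by (auto simp: PG_def frob_funpow_pt rational_iff)

text \<open>Each orbit point counts once, in a multiset that can be subtracted from one with
  repeated points. \<open>mset_set\<close> is empty on infinite sets, so finiteness of the orbit
  matters; it holds over \<open>GF q 6\<close>.\<close>

definition orb :: "('k ^ 7) set \<Rightarrow> ('k ^ 7) set multiset" where
  "orb P = mset_set (range (\<lambda>i. (frob q ^^ i) P))"

lemma orb_eq:
  fixes P :: "('k ^ 7) set"
  assumes "P \<in> PG q 6"
  shows "orb P = mset (map (\<lambda>i. (frob q ^^ i) P) [0..<orbit_size q P])"
proof -
  note * = card_funpow_orbit[of 6 "frob q" P, folded orbit_size_def, OF _ PG_fixed[OF assms]]
  have "orb P = image_mset (\<lambda>i. (frob q ^^ i) P) (mset_set {..<orbit_size q P})"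
    using * by (simp add: orb_def image_mset_mset_set)
  then show ?thesis by (simp add: lessThan_atLeast0)
qed

lemma orbit_size_notin_PG:
  fixes P :: "('k ^ 7) set"
  assumes "P \<in> PG q 6" "0 < d" "d < orbit_size q P"
  shows "P \<notin> PG q d"
proof
  assume "P \<in> PG q d"
  then have "(frob q ^^ d) P = (frob q ^^ 0) P" using PG_fixed[of P d] by simp
  moreover have "inj_on (\<lambda>i. (frob q ^^ i) P) {..<orbit_size q P}"
    using card_funpow_orbit(3)[of 6 "frob q" P, folded orbit_size_def] PG_fixed[OF assms(1)] by simp
  ultimately have "d = 0" using assms(2,3) by (elim inj_onD) auto
  then show False using assms(2) by simp
qed

lemma orbit_size_in_PG:
  fixes P :: "('k ^ 7) set"
  assumes "P \<in> PG q 6" "orbit_size q P = d"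
  shows "P \<in> PG q d"
  using card_funpow_orbit(2)[of 6 "frob q" P, folded orbit_size_def] PG_fixed[OF assms(1)] assms
    pt_in_PG_iff by (auto simp: PG_def frob_funpow_pt)

lemma range_frob:
  fixes P :: "('k ^ 7) set"
  assumes "P \<in> PG q 6"
  shows "range (\<lambda>i. (frob q ^^ i) ((frob q ^^ k) P)) = range (\<lambda>i. (frob q ^^ i) P)"
proof (intro equalityI image_subsetI)
  fix i
  show "(frob q ^^ i) ((frob q ^^ k) P) \<in> range (\<lambda>i. (frob q ^^ i) P)"
    by (intro image_eqI[of _ _ "i + k"]) (simp_all add: funpow_add)
  have "((frob q ^^ 6) ^^ k) P = P"
    using PG_fixed[OF assms] by (induction k) simp_all
  \<comment> \<open>Since the sixth power fixes \<open>P\<close>, another \<open>5 * k\<close> steps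
    undo the first \<open>k\<close>.\<close>
  moreover have "i + 5 * k + k = i + 6 * k" by simp
  ultimately have "(frob q ^^ (i + 5 * k + k)) P = (frob q ^^ i) P"
    by (simp only: funpow_mult funpow_add comp_apply)
  then show "(frob q ^^ i) P \<in> range (\<lambda>i. (frob q ^^ i) ((frob q ^^ k) P))"
    by (intro image_eqI[of _ _ "i + 5 * k"]) (simp_all only: funpow_add comp_apply UNIV_I)
qed

lemma orb_frob:
  fixes P :: "('k ^ 7) set"
  assumes "P \<in> PG q 6"
  shows "orb ((frob q ^^ k) P) = orb P"
  using assms by (simp add: orb_def range_frob)

lemma orbit_size_frob:
  fixes P :: "('k ^ 7) set"
  assumes "P \<in> PG q 6"
  shows "orbit_size q ((frob q ^^ k) P) = orbit_size q P"
  using assms by (simp add: orbit_size_def range_frob)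

lemma finite_orbit:
  fixes P :: "('k ^ 7) set"
  assumes "P \<in> PG q 6"
  shows "finite (range (\<lambda>i. (frob q ^^ i) P))"
  using card_funpow_orbit(4)[of 6 "frob q" P] PG_fixed[OF assms]
  by (metis finite_imageI finite_lessThan zero_less_numeral)

text \<open>An orbit is removed with multiplicity 1 only. Frobenius is injective and permutes the
  orbit, so the remainder is again invariant and can be split further, possibly by the same
  orbit.\<close>

lemma orbit_split:
  fixes P :: "('k ^ 7) set"
  assumes M: "image_mset (frob q) M = M" and P: "P \<in># M" "P \<in> PG q 6"
  obtains M' where "M = orb P + M'" "image_mset (frob q) M' = M'"
proof -
  let ?O = "range (\<lambda>i. (frob q ^^ i) P)"
  have "(frob q ^^ i) P \<in># M" for i
  proof (induction i)
    case (Suc i)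
    then have "frob q ((frob q ^^ i) P) \<in># image_mset (frob q) M" by simp
    then show ?case using M by simp
  qed (use P in simp)
  then have "orb P \<subseteq># mset_set (set_mset M)"
    unfolding orb_def by (intro subset_imp_msubset_mset_set) auto
  then have sub: "orb P \<subseteq># M"
    using mset_set_set_mset_msubset by (rule subset_mset.order_trans)
  have "inj (frob q :: ('k ^ 7) set \<Rightarrow> _)"
    using phi_funpow_inj[of 1] by (auto simp: inj_on_def frob_image inj_image_eq_iff)
  then have "image_mset (frob q) (orb P) = mset_set (frob q ` ?O)"
    unfolding orb_def by (intro image_mset_mset_set) (auto intro: inj_on_subset)
  also have "frob q ` ?O = range (\<lambda>i. (frob q ^^ i) ((frob q ^^ 1) P))"
    by (auto simp: image_comp funpow_swap1)
  finally have "image_mset (frob q) (orb P) = orb P"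
    unfolding range_frob[OF P(2)] orb_def .
  then have "image_mset (frob q) (M - orb P) = M - orb P"
    using M sub by (simp add: image_mset_Diff)
  then show ?thesis using sub that by (metis subset_mset.add_diff_inverse)
qed

lemma mem_orb:
  fixes P :: "('k ^ 7) set"
  assumes "P \<in> PG q 6"
  shows "(frob q ^^ i) P \<in># orb P"
  using finite_orbit[OF assms] by (simp add: orb_def)

lemma size_orb: "size (orb P) = orbit_size q P"
  by (simp add: orb_def orbit_size_def)

end

subsection \<open>The decomposition given by the transversal lines\<close>

locale transversal = frobenius q m \<phi>
  for q m and \<phi> :: "'k::alg_closed_field ^ 7 \<Rightarrow> 'k ^ 7" +
  fixes h :: "'k ^ 7" and g :: "('k ^ 7) set set"
  assumes h_nonzero: "h \<noteq> 0" and h_rational: "rational_vec q 1 h"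
    and transversal: "transversal_line q h g"
begin

text \<open>The \<open>i\<close>-th conjugate of \<open>g\<close>, spanned over all of
  \<open>'k\<close>. Indices run over all naturals although the family has period 3, so that
  applying \<open>\<phi>\<close> is just adding 1 to the index.\<close>

definition V :: "nat \<Rightarrow> ('k ^ 7) set" where
  "V i = (\<phi> ^^ i) ` vec.span (\<Union>g)"

lemma V_span: "V i = vec.span ((\<phi> ^^ i) ` \<Union>g)"
  by (simp add: V_def phi_funpow_span)

lemma subspace_V: "vec.subspace (V i)"
  by (simp add: V_span)

lemma V_add: "V (i + j) = (\<phi> ^^ i) ` V j"
  by (simp add: V_def funpow_add image_comp)

lemma phi_mem_V_iff: "(\<phi> ^^ i) v \<in> V (i + j) \<longleftrightarrow> v \<in> V j"
  by (auto simp: V_add dest: phi_funpow_inj)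

lemma g_points: "g \<subseteq> PG q 3" "pg_span q 3 g = g" "vec.dim (\<Union>g) = 2" "g \<subseteq> hyp q 3 h"
  using transversal by (auto simp: transversal_line_def pg_subspace_def)

lemma V_period: "V (i + 3) = V i"
proof -
  have "(\<phi> ^^ 3) ` P = P" if "P \<in> g" for P
  proof -
    have "P \<in> PG q 3" using g_points(1) that by blast
    moreover from this obtain v where v: "P = pt v" "v \<noteq> 0" by (auto simp: PG_def)
    ultimately show ?thesis using pt_in_PG_iff[of v 3] by (simp add: frob_funpow_image)
  qed
  then have "(\<phi> ^^ 3) ` \<Union>g = \<Union>g" by (auto simp: image_Union)
  then have "V 3 = V 0" by (simp add: V_span)
  then show ?thesis using V_add[of i 3] V_add[of i 0] by simp
qed

lemma V_mod: "V (i mod 3) = V i"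
proof -
  have "V (j + 3 * n) = V j" for j n
  proof (induction n)
    case (Suc n)
    then show ?case using V_period[of "j + 3 * n"] by (simp add: ac_simps)
  qed simp
  from this[of "i mod 3" "i div 3"] show ?thesis by simp
qed

lemma dim_V: "vec.dim (V i) \<le> 2"
proof -
  \<comment> \<open>As \<open>\<phi>\<close> is only semilinear, the dimension is bounded by
    carrying a basis of the line along and counting its image.\<close>
  obtain B where B: "B \<subseteq> \<Union>g" "vec.independent B" "\<Union>g \<subseteq> vec.span B" "card B = 2"
    using vec.basis_exists[of "\<Union>g"] g_points(3) by metis
  have fin: "finite B" using B(2) vec.finiteI_independent by blast
  have "vec.span (\<Union>g) = vec.span B"
    using B by (intro equalityI vec.span_minimal vec.span_mono) auto
  then have "V i = vec.span ((\<phi> ^^ i) ` B)" by (simp add: V_def phi_funpow_span)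
  then have "vec.dim (V i) \<le> card ((\<phi> ^^ i) ` B)"
    using fin vec.dim_le_card[of "V i" "(\<phi> ^^ i) ` B"] by simp
  also have "\<dots> \<le> 2" using card_image_le[OF fin, of "\<phi> ^^ i"] B(4) by simp
  finally show ?thesis .
qed

lemma V_subset_hyp: "v \<in> V i \<Longrightarrow> lin_form h v = 0"
proof -
  have "vec.span (\<Union>g) \<subseteq> {v. lin_form h v = 0}"
    using g_points(4) by (intro vec.span_minimal subspace_ker_lin_form) (auto simp: hyp_def)
  then show "v \<in> V i \<Longrightarrow> lin_form h v = 0"
    using q_gt_1 by (auto simp: V_def lin_form_phi_funpow[OF h_rational] power_0_left)
qed

lemma Union_frob: "\<Union>((frob q ^^ i) ` g) = (\<phi> ^^ i) ` \<Union>g"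
  by (auto simp: frob_funpow_image)

lemma frob_frob: "frob q ` frob q ` g = (frob q ^^ 2) ` g"
  by (simp add: image_comp numeral_2_eq_2)

text \<open>The transversal condition concerns only points over \<open>GF q 3\<close>. Descent with
  \<open>d = 3\<close> spans the kernel of \<open>h\<close> by such vectors, which extends the
  condition to all of \<open>'k ^ 7\<close>.\<close>

lemma hyp_decomposition:
  assumes "lin_form h v = 0"
  shows "v \<in> vec.span (V 0 \<union> V 1 \<union> V 2)"
proof -
  let ?H = "{v. lin_form h v = 0}" and ?S = "\<Union>(g \<union> frob q ` g \<union> frob q ` frob q ` g)"
  have "?S = \<Union>g \<union> \<phi> ` \<Union>g \<union> (\<phi> ^^ 2) ` \<Union>g"
    unfolding frob_frob Union_Un_distrib Union_frob using Union_frob[of 1] by simp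
  then have S: "vec.span ?S \<subseteq> vec.span (V 0 \<union> V 1 \<union> V 2)"
    by (intro vec.span_mono) (auto simp: V_span intro: vec.span_base)
  have "{w \<in> ?H. rational_vec q 3 w} \<subseteq> vec.span ?S"
  proof
    fix w assume w: "w \<in> {w \<in> ?H. rational_vec q 3 w}"
    show "w \<in> vec.span ?S"
    proof (cases "w = 0")
      case False
      then have "pt w \<in> hyp q 3 h"
        using w by (auto simp: pt_mem_hyp_iff PG_def)
      then have "pt w \<in> pg_span q 3 (g \<union> frob q ` g \<union> frob q ` frob q ` g)"
        using transversal by (simp add: transversal_line_def)
      then show ?thesis by (simp only: pg_span_def mem_Collect_eq pt_subset_span_iff)
    qed (simp add: vec.span_zero)
  qed
  then have "vec.span {w \<in> ?H. rational_vec q 3 w} \<subseteq> vec.span ?S"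
    by (intro vec.span_minimal) auto
  moreover have "v \<in> vec.span {w \<in> ?H. rational_vec q 3 w}"
    using assms q_gt_1
    by (intro descent subspace_ker_lin_form) (auto simp: lin_form_phi_funpow[OF h_rational] power_0_left)
  ultimately show ?thesis using S by blast
qed

text \<open>Three subspaces of dimension at most 2 span a space of dimension at least 6, so the
  dimension formula leaves nothing for \<open>V 0 \<inter> V 1\<close>. Applying powers of
  \<open>\<phi>\<close> gives the other consecutive pairs.\<close>

lemma V_disjoint_Suc:
  assumes "v \<in> V i" "v \<in> V (Suc i)"
  shows "v = 0"
proof -
  have dim_sum: "vec.dim (vec.span (A \<union> B)) + vec.dim (A \<inter> B) = vec.dim A + vec.dim B"
    if "vec.subspace A" "vec.subspace B" for A B :: "('k ^ 7) set"
    unfolding vec.span_Un vec.span_eq_iff[THEN iffD2, OF that(1)]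
      vec.span_eq_iff[THEN iffD2, OF that(2)]
    by (rule vec.dim_sums_Int[OF that])
  have "vec.dim (vec.span (vec.span (V 0 \<union> V 1) \<union> V 2))
      \<le> vec.dim (vec.span (V 0 \<union> V 1)) + vec.dim (V 2)"
    using dim_sum[of "vec.span (V 0 \<union> V 1)" "V 2"] subspace_V by simp
  moreover have "6 \<le> vec.dim (vec.span (vec.span (V 0 \<union> V 1) \<union> V 2))"
  proof -
    have "{v. lin_form h v = 0} \<subseteq> vec.span (vec.span (V 0 \<union> V 1) \<union> V 2)"
    proof
      fix v assume "v \<in> {v. lin_form h v = 0}"
      then have "v \<in> vec.span (V 0 \<union> V 1 \<union> V 2)" using hyp_decomposition by simp
      moreover have "V 0 \<union> V 1 \<union> V 2 \<subseteq> vec.span (V 0 \<union> V 1) \<union> V 2"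
        by (auto intro: vec.span_base)
      ultimately show "v \<in> vec.span (vec.span (V 0 \<union> V 1) \<union> V 2)"
        using vec.span_mono by blast
    qed
    then show ?thesis using dim_ker_lin_form[OF h_nonzero] vec.dim_subset by (meson order_trans)
  qed
  ultimately have "vec.dim (V 0 \<inter> V 1) = 0"
    using dim_sum[of "V 0" "V 1"] subspace_V dim_V[of 0] dim_V[of 1] dim_V[of 2]
    by (simp del: vec.dim_eq_0)
  then have zero: "V 0 \<inter> V 1 \<subseteq> {0}" by (simp add: vec.dim_eq_0)
  obtain u where u: "v = (\<phi> ^^ i) u" "u \<in> V 0"
    using assms(1) V_add[of i 0] by auto
  then have "u \<in> V 1" using assms(2) phi_mem_V_iff[of i u 1] by simp
  then show ?thesis using u zero by auto
qed

text \<open>Two different residues modulo 3 are always cyclic neighbours, so pairs of transversals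
  reduce to \<open>V i\<close> and \<open>V (Suc i)\<close>.\<close>

lemma V_eq_or_adjacent:
  obtains "V i = V j" | "V j = V (Suc i)" | "V i = V (Suc j)"
proof -
  have "i mod 3 < 3" "j mod 3 < 3" by simp_all
  then have "i mod 3 = j mod 3 \<or> j mod 3 = Suc i mod 3 \<or> i mod 3 = Suc j mod 3"
    unfolding mod_Suc by (auto split: if_splits)
  then consider "i mod 3 = j mod 3" | "j mod 3 = Suc i mod 3" | "i mod 3 = Suc j mod 3"
    by blast
  then show ?thesis
    using that V_mod[of i] V_mod[of j] V_mod[of "Suc i"] V_mod[of "Suc j"] by cases simp_all
qed

lemma V_disjoint:
  assumes "v \<in> V i" "v \<in> V j" "V i \<noteq> V j"
  shows "v = 0"
  using assms V_disjoint_Suc by (cases rule: V_eq_or_adjacent[of i j]) auto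

text \<open>For \<open>d\<close> divisible by 3 the map \<open>\<phi> ^^ d\<close> preserves each
  \<open>V i\<close>. A relation scaling \<open>a + b\<close> by \<open>k\<close> therefore splits
  into its two components, which meet only in 0.\<close>

lemma pt_summands_in_PG:
  assumes "a \<in> V i" "b \<in> V (Suc i)" "a \<noteq> 0" "b \<noteq> 0" and "pt (a + b) \<in> PG q d" "3 dvd d"
  shows "pt a \<in> PG q d" "pt b \<in> PG q d"
proof -
  have "a + b \<noteq> 0"
  proof
    assume "a + b = 0"
    then have "a = - b" by (simp add: eq_neg_iff_add_eq_0)
    then have "a \<in> V (Suc i)" using assms(2) subspace_V vec.subspace_neg by metis
    then show False using V_disjoint_Suc assms by blast
  qed
  then obtain k where k: "k \<noteq> 0" "(\<phi> ^^ d) (a + b) = k *s (a + b)"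
    using assms(5) pt_in_PG_iff[of "a + b" d] pt_eq_iff[of "(\<phi> ^^ d) (a + b)" "a + b"]
    by (auto simp: frob_funpow_pt)
  have Vd: "V (d + j) = V j" for j
    using V_mod[of "d + j"] V_mod[of j] assms(6) by (metis mod_add_left_eq add_0 dvd_imp_mod_0)
  have ab: "(\<phi> ^^ d) a \<in> V i" "(\<phi> ^^ d) b \<in> V (Suc i)"
    using assms(1,2) phi_mem_V_iff Vd by metis+
  have eq: "(\<phi> ^^ d) a - k *s a = k *s b - (\<phi> ^^ d) b"
    using k(2) by (simp add: phi_funpow_add vec.scale_right_distrib algebra_simps)
  have "(\<phi> ^^ d) a - k *s a \<in> V i"
    using ab assms subspace_V by (simp add: vec.subspace_diff vec.subspace_scale)
  moreover have "k *s b - (\<phi> ^^ d) b \<in> V (Suc i)"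
    using ab assms subspace_V by (simp add: vec.subspace_diff vec.subspace_scale)
  ultimately have 0: "(\<phi> ^^ d) a - k *s a = 0" using V_disjoint_Suc eq by metis
  then have "(\<phi> ^^ d) a = k *s a" "(\<phi> ^^ d) b = k *s b" using eq by auto
  then show "pt a \<in> PG q d" "pt b \<in> PG q d"
    using assms k(1) by (simp_all add: pt_in_PG_iff frob_funpow_pt pt_scale)
qed

subsection \<open>Weights and the spread\<close>

lemma mem_ext_transversals_iff:
  "t \<in> ext_transversals q g \<longleftrightarrow> (\<exists>i. t = {P \<in> PG q 6. P \<subseteq> V i})"
proof -
  have T: "pg_span q 6 ((frob q ^^ i) ` g) = {P \<in> PG q 6. P \<subseteq> V i}" for i
    unfolding pg_span_def Union_frob V_span ..
  have "(\<exists>i. t = {P \<in> PG q 6. P \<subseteq> V i}) \<longleftrightarrow> (\<exists>i<3. t = {P \<in> PG q 6. P \<subseteq> V i})"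
    (is "?E \<longleftrightarrow> ?B")
  proof
    assume ?E
    then obtain i where "t = {P \<in> PG q 6. P \<subseteq> V i}" ..
    then show ?B by (intro exI[of _ "i mod 3"]) (simp add: V_mod)
  qed blast
  also have "\<dots> \<longleftrightarrow> t \<in> ext_transversals q g"
    unfolding ext_transversals_def frob_frob
    using T[of 0] T[of 1] T[of 2] by (auto simp: numeral_3_eq_3 numeral_2_eq_2 less_Suc_eq)
  finally show ?thesis ..
qed

lemma pt_subset_V_iff: "pt v \<subseteq> V i \<longleftrightarrow> v \<in> V i"
  unfolding V_span by (rule pt_subset_span_iff)

lemma mem_transversal_iff:
  assumes "pt v \<in> PG q 6"
  shows "(\<exists>t\<in>ext_transversals q g. pt v \<in> t) \<longleftrightarrow> (\<exists>i. v \<in> V i)"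
proof -
  have "(\<exists>t\<in>ext_transversals q g. pt v \<in> t) \<longleftrightarrow> (\<exists>i. pt v \<in> {P \<in> PG q 6. P \<subseteq> V i})"
    unfolding Bex_def mem_ext_transversals_iff by blast
  then show ?thesis using assms by (simp add: pt_subset_V_iff)
qed

text \<open>The line in the definition of weight must be defined over \<open>GF q 6\<close>. Such a
  line is spanned by its points on the two transversals; conversely the summands of \<open>v\<close>
  are points over \<open>GF q 6\<close>, so they span a line of the required kind.\<close>

lemma line_through_transversals_iff:
  assumes v: "pt v \<in> PG q 6" "\<nexists>i. v \<in> V i"
  shows "(\<exists>l. pg_subspace q 6 1 l \<and> pt v \<in> l \<and>
                 (\<exists>t\<in>ext_transversals q g. \<exists>t'\<in>ext_transversals q g.
                    t \<noteq> t' \<and> l \<inter> t \<noteq> {} \<and> l \<inter> t' \<noteq> {}))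
     \<longleftrightarrow> (\<exists>i. v \<in> vec.span (V i \<union> V (Suc i)))" (is "?L \<longleftrightarrow> ?R")
proof
  assume ?L
  then obtain l t t' where l: "pg_subspace q 6 1 l" "pt v \<in> l"
    and t: "t \<in> ext_transversals q g" "t' \<in> ext_transversals q g"
      "t \<noteq> t'" "l \<inter> t \<noteq> {}" "l \<inter> t' \<noteq> {}"
    by blast
  obtain i j where tt': "t = {P \<in> PG q 6. P \<subseteq> V i}" "t' = {P \<in> PG q 6. P \<subseteq> V j}"
    using t(1,2) unfolding mem_ext_transversals_iff by blast
  then have ij: "V i \<noteq> V j" using t(3) by metis
  obtain X Y where XY: "X \<in> l" "Y \<in> l" "X \<subseteq> V i" "Y \<subseteq> V j" "X \<in> PG q 6" "Y \<in> PG q 6"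
    using t(4,5) unfolding tt' by blast
  obtain a b where ab: "X = pt a" "a \<noteq> 0" "Y = pt b" "b \<noteq> 0"
    using XY by (auto simp: PG_def)
  have V: "a \<in> V i" "b \<in> V j" using XY ab by (simp_all add: pt_subset_V_iff)
  have "a \<notin> vec.span {b}"
  proof
    assume "a \<in> vec.span {b}"
    then have "a \<in> V j" using V(2) subspace_V vec.span_minimal[of "{b}" "V j"] by auto
    then show False using V_disjoint[OF V(1) _ ij] ab by blast
  qed
  then have ind: "vec.independent {a, b}" "a \<noteq> b"
    using ab vec.independent_insertI[of a "{b}"] by (auto intro: vec.span_base)
  have "\<Union>l \<subseteq> vec.span {a, b}"
    using ind l XY mem_pt[of a] mem_pt[of b] ab
    by (intro vec.card_ge_dim_independent) (auto simp: pg_subspace_def)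
  then have "v \<in> vec.span {a, b}" using l(2) mem_pt by blast
  also have "vec.span {a, b} \<subseteq> vec.span (V i \<union> V j)" using V by (intro vec.span_mono) auto
  finally have "v \<in> vec.span (V i \<union> V j)" .
  then show ?R using ij by (cases rule: V_eq_or_adjacent[of i j]) (auto simp: Un_commute)
next
  assume ?R
  then obtain i where "v \<in> vec.span (V i \<union> V (Suc i))" by blast
  then obtain a b where ab: "v = a + b" "a \<in> V i" "b \<in> V (Suc i)"
    using vec.span_eq_iff[THEN iffD2, OF subspace_V] by (auto simp: vec.span_Un)
  then have nz: "a \<noteq> 0" "b \<noteq> 0" using v(2) by auto
  have PG: "pt a \<in> PG q 6" "pt b \<in> PG q 6" using pt_summands_in_PG[OF ab(2,3) nz] v(1) ab(1) by simp_all
  define l where "l = {P \<in> PG q 6. P \<subseteq> vec.span {a, b}}"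
  have "pt a \<in> l" "pt b \<in> l" using PG by (auto simp: l_def pt_subset_span_iff intro: vec.span_base)
  then have "{a, b} \<subseteq> \<Union>l" using mem_pt by blast
  then have span: "vec.span (\<Union>l) = vec.span {a, b}"
    by (intro equalityI vec.span_mono vec.span_minimal) (auto simp: l_def)
  have "a \<notin> vec.span {b}"
  proof
    assume "a \<in> vec.span {b}"
    then have "a \<in> V (Suc i)" using ab(3) subspace_V vec.span_minimal[of "{b}" "V (Suc i)"] by auto
    then show False using V_disjoint_Suc[OF ab(2)] nz by blast
  qed
  then have ind: "vec.independent {a, b}" "a \<noteq> b"
    using nz vec.independent_insertI[of a "{b}"] by (auto intro: vec.span_base)
  then have "vec.dim (\<Union>l) = 2"
    using vec.dim_span[of "\<Union>l"] span vec.dim_span_eq_card_independent[OF ind(1)] by simp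
  moreover have "pg_span q 6 l = l" unfolding pg_span_def span by (simp add: l_def)
  ultimately have line: "pg_subspace q 6 1 l" by (simp add: pg_subspace_def l_def)
  have "pt v \<in> l"
    using v ab by (auto simp: l_def pt_subset_span_iff intro: vec.span_add vec.span_base)
  let ?T = "\<lambda>i. {P \<in> PG q 6. P \<subseteq> V i}"
  have "pt a \<notin> ?T (Suc i)"
    using V_disjoint_Suc[OF ab(2)] nz by (auto simp: pt_subset_V_iff)
  moreover have T: "pt a \<in> ?T i" "pt b \<in> ?T (Suc i)"
    using ab PG by (auto simp: pt_subset_V_iff)
  ultimately have "?T i \<noteq> ?T (Suc i)" by metis
  moreover have "l \<inter> ?T i \<noteq> {}" "l \<inter> ?T (Suc i) \<noteq> {}"
    using T \<open>pt a \<in> l\<close> \<open>pt b \<in> l\<close> by auto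
  moreover have "?T i \<in> ext_transversals q g" "?T (Suc i) \<in> ext_transversals q g"
    unfolding mem_ext_transversals_iff by (rule exI, rule refl)+
  ultimately show ?L
    using line \<open>pt v \<in> l\<close> by (intro exI conjI bexI)
qed

lemma weight_pt:
  assumes "pt v \<in> PG q 6"
  shows "weight q g (pt v) =
    (if \<exists>i. v \<in> V i then 1 else if \<exists>i. v \<in> vec.span (V i \<union> V (Suc i)) then 2 else 3)"
  unfolding weight_def
  using mem_transversal_iff[OF assms] line_through_transversals_iff[OF assms] by simp

lemma weight_frob:
  assumes "P \<in> PG q 6"
  shows "weight q g (frob q P) = weight q g P"
proof -
  obtain v where v: "P = pt v" "v \<noteq> 0" using assms by (auto simp: PG_def)
  have "(frob q ^^ 6) (frob q P) = frob q ((frob q ^^ 6) P)"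
    by (simp only: funpow_swap1)
  then have PG: "pt (\<phi> v) \<in> PG q 6"
    using assms v pt_in_PG_iff[of v 6] pt_in_PG_iff[of "\<phi> v" 6] by (simp add: frob_pt)
  \<comment> \<open>The shift of index is absorbed by the quantifier. In the direction back to
    \<open>v\<close>, periodicity replaces \<open>i\<close> by \<open>i + 3\<close>, the successor
    of \<open>i + 2\<close>.\<close>
  have ex: "(\<exists>i. \<phi> v \<in> W i) \<longleftrightarrow> (\<exists>i. v \<in> W i)"
    if "\<And>i. \<phi> v \<in> W (Suc i) \<longleftrightarrow> v \<in> W i" "\<And>i. W (i + 3) = W i" for W
    using that by (metis add_Suc_right numeral_3_eq_3)
  have "(\<exists>i. \<phi> v \<in> V i) \<longleftrightarrow> (\<exists>i. v \<in> V i)"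
    using phi_mem_V_iff[of 1 v] V_period by (intro ex) simp_all
  moreover have "\<phi> v \<in> vec.span (V (Suc i) \<union> V (Suc (Suc i)))
      \<longleftrightarrow> v \<in> vec.span (V i \<union> V (Suc i))" for i
  proof -
    have "V (Suc i) = \<phi> ` V i" for i using V_add[of 1 i] by simp
    then have "vec.span (V (Suc i) \<union> V (Suc (Suc i))) = \<phi> ` vec.span (V i \<union> V (Suc i))"
      by (simp add: phi_span image_Un)
    then show ?thesis using phi_funpow_inj[of 1] by auto
  qed
  then have "(\<exists>i. \<phi> v \<in> vec.span (V i \<union> V (Suc i))) \<longleftrightarrow> (\<exists>i. v \<in> vec.span (V i \<union> V (Suc i)))"
    using V_period V_period[of "Suc _"] by (intro ex) simp_all
  ultimately show ?thesis
    using weight_pt[OF PG] weight_pt[of v] assms by (simp add: v frob_pt)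
qed

text \<open>
  The rational points of the plane \<open>\<langle>X, X\<^sup>q, X\<^sup>q\<^sup>2\<rangle>\<close> span it, by descent, so the extension of the
  spread element contains every point over GF(\<open>q ^ 6\<close>) of that plane.
\<close>

lemma spread_index_eq_1:
  assumes x: "pt x \<in> g" and v: "v \<in> vec.span {x, \<phi> x, \<phi> (\<phi> x)}" and PG: "pt v \<in> PG q 6"
  shows "spread_index q h g (pt v) = 1"
proof -
  let ?W = "vec.span {x, \<phi> x, \<phi> (\<phi> x)}"
  define \<pi> where "\<pi> = pg_span q 3 {pt x, frob q (pt x), frob q (frob q (pt x))} \<inter> hyp q 1 h"
  have "x \<noteq> 0"
  proof
    assume "x = 0"
    then show False
      using x g_points(1) vec.span_base[of _ "{_}"] by (fastforce simp: PG_def pt_def)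
  qed
  have "x \<in> V 0" using x by (auto simp: V_def pt_def intro!: vec.span_base vec.span_base[of x "{x}"])
  then have xV: "x \<in> V 0" "\<phi> x \<in> V 1" "\<phi> (\<phi> x) \<in> V 2"
    using phi_mem_V_iff[of 1 x 0] phi_mem_V_iff[of 2 x 0] by (simp_all add: numeral_2_eq_2)
  have WH: "?W \<subseteq> {v. lin_form h v = 0}"
    using xV V_subset_hyp by (intro vec.span_minimal subspace_ker_lin_form) auto
  \<comment> \<open>The third image is a multiple of \<open>x\<close> because \<open>pt x\<close>
    lies over \<open>GF q 3\<close>. This closes the plane under \<open>\<phi>\<close>, as descent
    with \<open>d = 1\<close> requires.\<close>
  have "(\<phi> ^^ 3) x \<in> vec.span {x}"
    using x \<open>x \<noteq> 0\<close> g_points(1) pt_in_PG_iff[of x 3]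
    by (auto simp: frob_funpow_pt) (metis insertI1 pt_def vec.span_base)
  then have x3: "\<phi> (\<phi> (\<phi> x)) \<in> ?W"
    using vec.span_mono[of "{x}" "{x, \<phi> x, \<phi> (\<phi> x)}"] by (auto simp: numeral_3_eq_3)
  have inv: "\<phi> w \<in> ?W" if "w \<in> ?W" for w
  proof -
    have "\<phi> w \<in> vec.span (\<phi> ` {x, \<phi> x, \<phi> (\<phi> x)})"
      using that unfolding phi_span[symmetric] by (rule imageI)
    moreover have "vec.span (\<phi> ` {x, \<phi> x, \<phi> (\<phi> x)}) \<subseteq> ?W"
      using x3 by (intro vec.span_minimal) (auto intro: vec.span_base)
    ultimately show ?thesis by blast
  qed
  have plane: "vec.span (\<Union>{pt x, frob q (pt x), frob q (frob q (pt x))}) = ?W"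
  proof
    show "vec.span (\<Union>{pt x, frob q (pt x), frob q (frob q (pt x))}) \<subseteq> ?W"
    proof (rule vec.span_minimal)
      have "pt y \<subseteq> ?W" if "y \<in> {x, \<phi> x, \<phi> (\<phi> x)}" for y
        unfolding pt_subset_span_iff using that by (rule vec.span_base)
      then show "\<Union>{pt x, frob q (pt x), frob q (frob q (pt x))} \<subseteq> ?W"
        unfolding frob_pt by simp
    qed simp
    show "?W \<subseteq> vec.span (\<Union>{pt x, frob q (pt x), frob q (frob q (pt x))})"
      unfolding frob_pt unfolding pt_def by (intro vec.span_mono) (auto intro: vec.span_base)
  qed
  have "{w \<in> ?W. rational_vec q 1 w} \<subseteq> vec.span (\<Union>\<pi>)"
  proof
    fix w assume w: "w \<in> {w \<in> ?W. rational_vec q 1 w}"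
    show "w \<in> vec.span (\<Union>\<pi>)"
    proof (cases "w = 0")
      case False
      then have 1: "pt w \<in> PG q 1" using w by (auto simp: PG_def)
      then have "pt w \<in> PG q 3" by (rule PG_mono_dvd) simp
      moreover have "lin_form h w = 0" using w WH by auto
      ultimately have "pt w \<in> \<pi>"
        using w 1 unfolding \<pi>_def pg_span_def plane pt_subset_span_iff hyp_def
        by (simp only: Int_iff mem_Collect_eq pt_subset_lin_form pt_subset_span_iff)
      then show ?thesis by (auto simp: pt_def intro!: vec.span_base vec.span_base[of w "{w}"])
    qed (simp add: vec.span_zero)
  qed
  then have "vec.span {w \<in> ?W. rational_vec q 1 w} \<subseteq> vec.span (\<Union>\<pi>)"
    by (intro vec.span_minimal) auto
  moreover have "v \<in> vec.span {w \<in> ?W. rational_vec q 1 w}"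
    using v inv by (intro descent) auto
  ultimately have "pt v \<in> pg_span q 6 \<pi>"
    using PG by (auto simp: pg_span_def pt_subset_span_iff)
  moreover have "\<pi> \<in> regular_spread q h g"
    using x by (auto simp: regular_spread_def \<pi>_def)
  ultimately show ?thesis by (auto simp: spread_index_def)
qed

lemma pt_in_g_iff: "pt v \<in> g \<longleftrightarrow> pt v \<in> PG q 3 \<and> v \<in> V 0"
proof -
  have "pt v \<in> pg_span q 3 g \<longleftrightarrow> pt v \<in> PG q 3 \<and> v \<in> V 0"
    unfolding pg_span_def mem_Collect_eq pt_subset_span_iff by (simp add: V_def)
  then show ?thesis by (simp add: g_points)
qed

lemma g_notin_PG_1: "P \<in> g \<Longrightarrow> P \<notin> PG q 1"
  using transversal g_points(4) by (auto simp: transversal_line_def hyp_def)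

text \<open>Going back by \<open>i\<close> places is replaced by going forward by
  \<open>2 * i\<close>, since the total shift \<open>3 * i\<close> is a multiple of the
  period.\<close>

lemma rotate_V:
  assumes "v \<in> V (i + j)"
  shows "(\<phi> ^^ (2 * i)) v \<in> V j"
proof -
  have "(\<phi> ^^ (2 * i)) v \<in> V (2 * i + (i + j))" using assms phi_mem_V_iff by blast
  moreover have "2 * i + (i + j) = j + 3 * i" by simp
  ultimately show ?thesis using V_mod[of "j + 3 * i"] V_mod[of j] by simp
qed

subsection \<open>Orbits of good points\<close>

lemma weight_frob_funpow:
  assumes "P \<in> PG q 6"
  shows "weight q g ((frob q ^^ i) P) = weight q g P"
  using assms by (induction i) (simp_all add: weight_frob frob_funpow_in_PG_iff)

lemma weight_bounds: "1 \<le> weight q g P" "weight q g P \<le> 3"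
  by (auto simp: weight_def)

lemma sum_weight_orb:
  assumes "P \<in> PG q 6"
  shows "(\<Sum>Q\<in>#orb P. weight q g Q) = weight q g P * orbit_size q P"
proof -
  have "weight q g Q = weight q g P" if Q: "Q \<in># orb P" for Q
  proof -
    have "Q \<in> range (\<lambda>i. (frob q ^^ i) P)"
      using Q finite_set_mset_mset_set[OF finite_orbit[OF assms]] unfolding orb_def by blast
    then obtain i where "Q = (frob q ^^ i) P" by blast
    then show ?thesis using weight_frob_funpow[OF assms] by simp
  qed
  then have "image_mset (weight q g) (orb P) = image_mset (\<lambda>_. weight q g P) (orb P)"
    by (rule image_mset_cong)
  then show ?thesis by (simp add: size_orb)
qed

lemma weight_pt_eq_1_iff:
  assumes "pt v \<in> PG q 6"
  shows "weight q g (pt v) = 1 \<longleftrightarrow> (\<exists>i. v \<in> V i)"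
  unfolding weight_pt[OF assms] by simp

lemma weight_pt_eq_2:
  assumes "pt v \<in> PG q 6" "weight q g (pt v) = 2"
  shows "\<exists>i. v \<in> vec.span (V i \<union> V (Suc i))"
proof (rule ccontr)
  assume "\<not> ?thesis"
  then have "weight q g (pt v) \<noteq> 2" unfolding weight_pt[OF assms(1)] by simp
  then show False using assms(2) by simp
qed

lemma weight_1_orbit:
  assumes "P \<in> PG q 6" "weight q g P = 1"
  obtains v where "v \<noteq> 0" "v \<in> V 0" "pt v \<in> PG q 6" "orb P = orb (pt v)"
    "orbit_size q (pt v) = orbit_size q P"
proof -
  obtain v where v: "P = pt v" "v \<noteq> 0" using assms(1) by (auto simp: PG_def)
  then obtain i where "v \<in> V i"
    using assms weight_pt_eq_1_iff[of v] by auto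
  then have "(\<phi> ^^ (2 * i)) v \<in> V 0" using rotate_V[of v i 0] by simp
  then show ?thesis
    using that[of "(\<phi> ^^ (2 * i)) v"] v assms(1) orb_frob[of P "2 * i"] orbit_size_frob[of P "2 * i"]
      frob_funpow_in_PG_iff[of P 6 "2 * i" 6]
    by (simp add: frob_funpow_pt)
qed

lemma weight_1_orbit_3:
  assumes "P \<in> PG q 6" "weight q g P = 1" "orbit_size q P = 3"
  obtains X where "X \<in> g" "orb P = {#X, frob q X, (frob q ^^ 2) X#}"
proof -
  obtain v where v: "v \<in> V 0" "pt v \<in> PG q 6" "orb P = orb (pt v)" "orbit_size q (pt v) = 3"
    using weight_1_orbit[OF assms(1,2)] assms(3) by metis
  have "pt v \<in> g" using v orbit_size_in_PG by (auto simp: pt_in_g_iff)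
  moreover have "orb P = {#pt v, frob q (pt v), (frob q ^^ 2) (pt v)#}"
    using v orb_eq[OF v(2)] by (simp add: eval_nat_numeral)
  ultimately show ?thesis using that by blast
qed

lemma weight_1_orbit_6:
  assumes "P \<in> PG q 6" "weight q g P = 1" "orbit_size q P = 6"
  obtains X where "X \<in> pg_span q 6 g - g"
    "orb P = {#X, frob q X, (frob q ^^ 2) X, (frob q ^^ 3) X, (frob q ^^ 4) X, (frob q ^^ 5) X#}"
proof -
  obtain v where v: "v \<in> V 0" "pt v \<in> PG q 6" "orb P = orb (pt v)" "orbit_size q (pt v) = 6"
    using weight_1_orbit[OF assms(1,2)] assms(3) by metis
  have "pt v \<notin> g" using v orbit_size_notin_PG[of "pt v" 3] by (simp add: pt_in_g_iff)
  moreover have "pt v \<in> pg_span q 6 g"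
    using v unfolding pg_span_def mem_Collect_eq pt_subset_span_iff by (simp add: V_def)
  moreover have "orb P = {#pt v, frob q (pt v), (frob q ^^ 2) (pt v), (frob q ^^ 3) (pt v),
      (frob q ^^ 4) (pt v), (frob q ^^ 5) (pt v)#}"
    using v orb_eq[OF v(2)] by (simp add: eval_nat_numeral)
  ultimately show ?thesis using that by blast
qed

text \<open>After rotation the components lie in \<open>V 0\<close> and \<open>V 1\<close>; the
  first gives \<open>X\<close>, and pulling the second back by \<open>\<phi>\<close> gives
  \<open>Y\<close>. Goodness is assumed along the whole orbit because it is applied to the rotated
  point.\<close>

lemma weight_2_orbit_3:
  assumes P: "P \<in> PG q 6" "weight q g P = 2" "orbit_size q P = 3"
    and good: "\<And>Q. Q \<in># orb P \<Longrightarrow> S_good q h g Q"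
  obtains R X Y where "X \<in> g" "Y \<in> g" "X \<noteq> Y" "R \<in> pg_span q 3 {X, frob q Y}" "R \<noteq> X"
    "R \<noteq> frob q Y" "orb P = {#R, frob q R, (frob q ^^ 2) R#}"
proof -
  obtain v where v: "P = pt v" "v \<noteq> 0" using P(1) by (auto simp: PG_def)
  then obtain i where "v \<in> vec.span (V i \<union> V (Suc i))"
    using P weight_pt_eq_2[of v] by auto
  then obtain a b where ab: "v = a + b" "a \<in> V i" "b \<in> V (Suc i)"
    using vec.span_eq_iff[THEN iffD2, OF subspace_V] by (auto simp: vec.span_Un)
  define w where "w = (\<phi> ^^ (2 * i)) v"
  define a' where "a' = (\<phi> ^^ (2 * i)) a"
  define b' where "b' = (\<phi> ^^ (2 * i)) b"
  have ab': "w = a' + b'" "a' \<in> V 0" "b' \<in> V 1"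
    using ab rotate_V[of a i 0] rotate_V[of b i 1]
    by (simp_all add: w_def a'_def b'_def phi_funpow_add)
  have w: "pt w = (frob q ^^ (2 * i)) P" by (simp add: w_def v frob_funpow_pt)
  have w6: "pt w \<in> PG q 6" using P(1) frob_funpow_in_PG_iff by (simp add: w)
  have w2: "weight q g (pt w) = 2" using weight_frob_funpow P by (simp add: w)
  have w3: "orbit_size q (pt w) = 3" using orbit_size_frob P by (simp add: w)
  have "S_good q h g (pt w)" unfolding w by (intro good mem_orb P(1))
  then have index: "spread_index q h g (pt w) = 2" using w2 w3 by (simp add: S_good_def)
  have nin: "w \<notin> V j" for j using weight_pt_eq_1_iff[OF w6] w2 by auto
  have nz: "a' \<noteq> 0" "b' \<noteq> 0" using ab' nin[of 0] nin[of 1] by auto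
  have PG3: "pt w \<in> PG q 3" using orbit_size_in_PG[OF w6 w3] .
  then have PG_ab: "pt a' \<in> PG q 3" "pt b' \<in> PG q 3"
    using pt_summands_in_PG[of a' 0 b' 3] ab' nz by simp_all
  obtain y where y: "b' = \<phi> y" "y \<in> V 0" using ab'(3) V_add[of 1 0] by auto
  have frob_y: "frob q (pt y) = pt b'" by (simp add: frob_pt y)
  have "y \<noteq> 0" using y nz by auto
  then have "pt y \<in> PG q 3"
    using PG_ab(2) frob_y frob_funpow_pt_in_PG_iff[of y 1 3] by simp
  then have g: "pt a' \<in> g" "pt y \<in> g" using PG_ab ab' y by (simp_all add: pt_in_g_iff)
  have neq: "pt a' \<noteq> pt y"
  \<comment> \<open>If the points agreed, the second component would be a multiple of
    \<open>\<phi> a'\<close>, and \<open>w\<close> would lie in an extended spread plane, against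
    index 2.\<close>
  proof
    assume "pt a' = pt y"
    then have "pt (\<phi> a') = pt b'" using frob_y by (metis frob_pt)
    then obtain k where "b' = k *s \<phi> a'" using nz pt_eq_iff[of b'] by metis
    then have "w \<in> vec.span {a', \<phi> a', \<phi> (\<phi> a')}"
      unfolding ab'(1) by (auto intro!: vec.span_add vec.span_scale intro: vec.span_base)
    then show False using spread_index_eq_1[OF g(1) _ w6] index by simp
  qed
  have "w \<in> vec.span (\<Union>{pt a', pt b'})"
    unfolding ab'(1) using mem_pt by (intro vec.span_add vec.span_base) auto
  then have "pt w \<in> pg_span q 3 {pt a', frob q (pt y)}"
    unfolding pg_span_def mem_Collect_eq pt_subset_span_iff frob_y using PG3 by simp
  moreover have "pt w \<noteq> pt a'" "pt w \<noteq> frob q (pt y)"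
    using nin ab' mem_pt[of w] pt_subset_V_iff unfolding frob_y by blast+
  moreover have "orb P = orb (pt w)" using orb_frob[OF P(1)] by (simp add: w)
  then have "orb P = {#pt w, frob q (pt w), (frob q ^^ 2) (pt w)#}"
    using orb_eq[OF w6] w3 by (simp add: eval_nat_numeral)
  ultimately show ?thesis using that g neq by blast
qed

text \<open>With period 2 the third power of Frobenius acts on \<open>P\<close> as the first. Lying
  over \<open>GF q 3\<close> would therefore make \<open>P\<close> rational and its orbit a single
  point.\<close>

lemma weight_3_orbit_2:
  assumes P: "P \<in> hyp q 6 h" "weight q g P = 3" "orbit_size q P = 2"
  shows "P \<in> hyp q 6 h - hyp q 3 h" "\<forall>t \<in> ext_transversals q g. P \<notin> t"
    "orb P = {#P, (frob q ^^ 3) P#}"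
proof -
  have P6: "P \<in> PG q 6" using P(1) by (simp add: hyp_def)
  have P2: "(frob q ^^ 2) P = P" using orbit_size_in_PG[OF P6 P(3)] by (rule PG_fixed)
  then have P3: "(frob q ^^ 3) P = frob q P" by (simp add: numeral_3_eq_3 numeral_2_eq_2)
  have "P \<notin> PG q 3"
  proof
    assume "P \<in> PG q 3"
    then have "frob q P = P" using PG_fixed P3 by metis
    then have "P \<in> PG q 1" using P6 pt_in_PG_iff[of _ 1] by (auto simp: PG_def)
    then show False using orbit_size_notin_PG[of P 1] P6 P(3) by simp
  qed
  then show "P \<in> hyp q 6 h - hyp q 3 h" using P(1) by (simp add: hyp_def)
  show "\<forall>t \<in> ext_transversals q g. P \<notin> t" using P(2) by (auto simp: weight_def split: if_splits)
  show "orb P = {#P, (frob q ^^ 3) P#}"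
    using orb_eq[OF P6] P(3) P3 by (simp add: numeral_2_eq_2)
qed

lemma orbit_1:
  assumes "P \<in> hyp q 6 h" "orbit_size q P = 1"
  shows "P \<in> hyp q 1 h" "P \<in> PG q 1" "orb P = {#P#}"
proof -
  have P6: "P \<in> PG q 6" using assms(1) by (simp add: hyp_def)
  show "P \<in> PG q 1" using orbit_size_in_PG[OF P6 assms(2)] .
  then show "P \<in> hyp q 1 h" using assms(1) by (simp add: hyp_def)
  show "orb P = {#P#}" using orb_eq[OF P6] assms(2) by simp
qed

lemma good_orbits:
  assumes M: "image_mset (frob q) M = M" "\<And>P. P \<in># M \<Longrightarrow> S_good q h g P"
    and sum: "(\<Sum>P\<in>#M. weight q g P) = 6"
  obtains P where "P \<in># M" "M = orb P" "weight q g P * orbit_size q P = 6"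
  | P Q where "P \<in># M" "Q \<in># M" "M = orb P + orb Q"
    "weight q g P * orbit_size q P = 3" "weight q g Q * orbit_size q Q = 3"
proof -
  have M6: "P \<in> PG q 6" if "P \<in># M" for P
    using M(2)[OF that] by (simp add: S_good_def hyp_def)
  have index: "weight q g P * orbit_size q P \<in> {3, 6}" if "P \<in># M" for P
    using M(2)[OF that] by (simp add: S_good_def spread_index_def)
  \<comment> \<open>Every weight is at least 1, so a remainder of total weight 0 contains no
    points.\<close>
  have empty: "N = {#}" if "(\<Sum>P\<in>#N. weight q g P) = 0" for N
  proof (rule ccontr)
    assume "N \<noteq> {#}"
    then obtain P where "P \<in># N" by blast
    then have "weight q g P \<le> (\<Sum>P\<in>#N. weight q g P)"
      by (metis image_mset_add_mset insert_DiffM le_add1 sum_mset.add_mset)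
    then show False using that weight_bounds(1)[of P] by simp
  qed
  obtain P where P: "P \<in># M" using sum by fastforce
  obtain M' where M': "M = orb P + M'" "image_mset (frob q) M' = M'"
    using orbit_split[OF M(1) P M6[OF P]] .
  have sum': "weight q g P * orbit_size q P + (\<Sum>P\<in>#M'. weight q g P) = 6"
    using sum sum_weight_orb[OF M6[OF P]] by (simp add: M'(1))
  show ?thesis
  proof (cases "weight q g P * orbit_size q P = 6")
    case True
    then have "M' = {#}" using sum' by (intro empty) simp
    then show ?thesis using that(1) P M'(1) True by simp
  next
    case False
    then have P3: "weight q g P * orbit_size q P = 3" using index[OF P] by simp
    then have sum3: "(\<Sum>P\<in>#M'. weight q g P) = 3" using sum' by simp
    then obtain Q where "Q \<in># M'" by fastforce
    \<comment> \<open>\<open>Q\<close> is taken from the remainder, so it may coincide with a point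
      of the first orbit; this produces the repeated points in the statement.\<close>
    then have Q: "Q \<in># M'" "Q \<in># M" by (simp_all add: M'(1))
    obtain M'' where M'': "M' = orb Q + M''"
      using orbit_split[OF M'(2) Q(1) M6[OF Q(2)]] .
    have sum'': "weight q g Q * orbit_size q Q + (\<Sum>P\<in>#M''. weight q g P) = 3"
      using sum3 sum_weight_orb[OF M6[OF Q(2)]] by (simp add: M'')
    then have "weight q g Q * orbit_size q Q = 3" using index[OF Q(2)] by auto
    moreover from this have "M'' = {#}" using sum'' by (intro empty) simp
    ultimately show ?thesis using that(2)[OF P Q(2)] P3 M'(1) M'' by simp
  qed
qed

end

section \<open>The six curve types read off from the orbit types\<close>

theorem theorem5p3:
  fixes p m q r :: nat
    and h :: "'k::alg_closed_field ^ 7"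
    and g :: "('k ^ 7) set set"
    and c :: "nat \<Rightarrow> 'k ^ 7"
  assumes "prime p" and "CHAR('k) = p" and "0 < m" and "q = p ^ m" and "8 \<le> q"
    and "h \<noteq> 0" and "rational_vec q 1 h"
    and "transversal_line q h g"
    and "nrc_frame q r c" and "three_special q h g r c"
  shows
    "(r = 6 \<and> (\<exists>P\<in>g. \<exists>Q\<in>g.
        meet_pts_over q 3 r h c =
          {#P, frob q P, (frob q ^^ 2) P, Q, frob q Q, (frob q ^^ 2) Q#}))
   \<or> (r = 6 \<and> (\<exists>P \<in> pg_span q 6 g - g.
        meet_pts_over q 6 r h c =
          {#P, frob q P, (frob q ^^ 2) P, (frob q ^^ 3) P, (frob q ^^ 4) P, (frob q ^^ 5) P#}))
   \<or> (r = 4 \<and> (\<exists>T. \<exists>P\<in>g.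
        meet_pts_over q 1 r h c = {#T#} \<and>
        meet_pts_over q 3 r h c = {#T, P, frob q P, (frob q ^^ 2) P#} \<and>
        T \<notin> pg_span q 3 {P, frob q P, (frob q ^^ 2) P}))
   \<or> (r = 3 \<and> (\<exists>R. \<exists>X\<in>g. \<exists>Y\<in>g.
        X \<noteq> Y \<and> R \<in> pg_span q 3 {X, frob q Y} \<and> R \<noteq> X \<and> R \<noteq> frob q Y \<and>
        meet_pts_over q 3 r h c = {#R, frob q R, (frob q ^^ 2) R#}))
   \<or> (r = 2 \<and> (\<exists>P \<in> hyp q 1 h. \<exists>Q \<in> hyp q 1 h.
        meet_pts_over q 1 r h c = {#P, Q#}))
   \<or> (r = 2 \<and> (\<exists>P \<in> hyp q 6 h - hyp q 3 h.
        (\<forall>t \<in> ext_transversals q g. P \<notin> t) \<and>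
        meet_pts_over q 6 r h c = {#P, (frob q ^^ 3) P#}))"
    (is "?C1 \<or> ?C2 \<or> ?C3 \<or> ?C4 \<or> ?C5 \<or> ?C6")
proof -
  define \<phi> :: "'k ^ 7 \<Rightarrow> 'k ^ 7" where "\<phi> = (\<lambda>v. \<chi> i. (v $ i) ^ q)"
  interpret transversal q m \<phi> h g
    using assms by unfold_locales (simp_all add: prime_gt_0_nat \<phi>_def)
  note c = \<open>nrc_frame q r c\<close> and sp = \<open>three_special q h g r c\<close>
  let ?M = "meet_pts r h c"
  have good: "S_good q h g P" if "P \<in># ?M" for P
    using sp that by (simp add: three_special_def)
  have M6: "P \<in> hyp q 6 h" "P \<in> PG q 6" if "P \<in># ?M" for P
    using good[OF that] by (simp_all add: S_good_def hyp_def)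
  \<comment> \<open>Once every point at infinity lies over \<open>GF q d\<close>, the filter removes
    nothing, and an alternative only has to describe \<open>?M\<close>. The dimension
    \<open>r\<close> is then the number of points in it.\<close>
  have over: "meet_pts_over q d r h c = ?M" if "set_mset ?M \<subseteq> PG q d" for d
    using that by (auto simp: meet_pts_over_def filter_mset_eq_conv)
  have r: "size ?M = r" by (rule size_meet_pts)
  have sum: "(\<Sum>P\<in>#?M. weight q g P) = 6" using sp by (simp add: three_special_def)
  have g3: "(frob q ^^ i) X \<in> PG q 3" "(frob q ^^ i) X \<notin> PG q 1" if "X \<in> g" for X i
  proof -
    have "X \<in> PG q 3" using that g_points(1) by blast
    then show "(frob q ^^ i) X \<in> PG q 3" "(frob q ^^ i) X \<notin> PG q 1"
      using frob_funpow_in_PG_iff[of X 3 i] g_notin_PG_1[OF that] by simp_all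
  qed
  \<comment> \<open>When two orbits contribute 3 each, weight 2 is impossible because 3 is
    odd.\<close>
  have prods: "(a = 1 \<and> b = 3) \<or> (a = 3 \<and> b = 1)" if "a * b = 3" "1 \<le> a" "a \<le> 3" for a b :: nat
  proof -
    have "a = 1 \<or> a = 2 \<or> a = 3" using that by linarith
    then show ?thesis using that(1) by (elim disjE) (simp_all, arith)
  qed
  consider (one) P where "P \<in># ?M" "?M = orb P" "weight q g P * orbit_size q P = 6"
    | (two) P Q where "P \<in># ?M" "Q \<in># ?M" "?M = orb P + orb Q"
      "weight q g P * orbit_size q P = 3" "weight q g Q * orbit_size q Q = 3"
    using good_orbits[OF frob_meet_pts[OF c h_rational] good sum] by blast
  then show ?thesis
  proof cases
    case (one P)
    note P = M6[OF one(1)]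
    have "weight q g P = 1 \<or> weight q g P = 2 \<or> weight q g P = 3"
      using weight_bounds[of P] by linarith
    then show ?thesis
    proof (elim disjE)
      assume w: "weight q g P = 1"
      then obtain X where X: "X \<in> pg_span q 6 g - g"
        "?M = {#X, frob q X, (frob q ^^ 2) X, (frob q ^^ 3) X, (frob q ^^ 4) X, (frob q ^^ 5) X#}"
        using weight_1_orbit_6[OF P(2)] one(2,3) by auto
      moreover have "meet_pts_over q 6 r h c = ?M" using M6(2) by (intro over) blast
      moreover have "r = 6" using r unfolding X(2) by simp
      ultimately have ?C2 by auto
      then show ?thesis by blast
    next
      assume w: "weight q g P = 2"
      then have o: "orbit_size q P = 3" using one(3) by simp
      have "S_good q h g Q" if "Q \<in># orb P" for Q using good that one(2) by simp
      then obtain R X Y where R: "X \<in> g" "Y \<in> g" "X \<noteq> Y" "R \<in> pg_span q 3 {X, frob q Y}"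
        "R \<noteq> X" "R \<noteq> frob q Y" "?M = {#R, frob q R, (frob q ^^ 2) R#}"
        using weight_2_orbit_3[OF P(2) w o] one(2) by metis
      have "R \<in> PG q 3" using R(4) by (simp add: pg_span_def)
      then have "(frob q ^^ i) R \<in> PG q 3" for i using frob_funpow_in_PG_iff by blast
      from this[of 0] this[of 1] this[of 2] have "set_mset ?M \<subseteq> PG q 3" by (simp add: R(7))
      then have "meet_pts_over q 3 r h c = ?M" by (rule over)
      moreover have "r = 3" using r unfolding R(7) by simp
      ultimately have ?C4 using R by metis
      then show ?thesis by blast
    next
      assume w: "weight q g P = 3"
      then have o: "orbit_size q P = 2" using one(3) by simp
      note W = weight_3_orbit_2[OF P(1) w o]
      have "meet_pts_over q 6 r h c = ?M" using M6(2) by (intro over) blast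
      moreover have "r = 2" using r unfolding one(2) by (simp add: size_orb o)
      ultimately have ?C6 using W one(2) by metis
      then show ?thesis by blast
    qed
  next
    case (two P Q)
    note P = M6[OF two(1)] and Q = M6[OF two(2)]
    \<comment> \<open>Stated for arbitrary \<open>S\<close> and \<open>T\<close> to serve both
      orders in which the rational point and the triple can occur.\<close>
    have mixed: ?C3
      if M: "?M = orb S + orb T" and ST: "S \<in># ?M" "T \<in># ?M" and
        w: "weight q g S = 1" "orbit_size q S = 3" "orbit_size q T = 1" for S T
    proof -
      note T = orbit_1[OF M6(1)[OF ST(2)] w(3)]
      obtain X where X: "X \<in> g" "orb S = {#X, frob q X, (frob q ^^ 2) X#}"
        using weight_1_orbit_3[OF M6(2)[OF ST(1)] w(1,2)] .
      have M': "?M = {#T, X, frob q X, (frob q ^^ 2) X#}" using M T(3) X(2) by simp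
      have r4: "r = 4" using r unfolding M' by simp
      note X3 = g3[OF X(1), of 0, simplified] g3[OF X(1), of 1, simplified] g3[OF X(1), of 2]
      have "T \<in> PG q 3" using T(2) by (rule PG_mono_dvd) simp
      then have "meet_pts_over q 3 r h c = {#T, X, frob q X, (frob q ^^ 2) X#}"
        "meet_pts_over q 1 r h c = {#T#}"
        using T(2) X3 by (simp_all add: meet_pts_over_def M')
      \<comment> \<open>The conjugates on the transversals are irrational and \<open>T\<close> is
        rational, so general position on a curve of dimension 4 keeps \<open>T\<close> off their
        plane.\<close>
      moreover have "set [X, frob q X, (frob q ^^ 2) X] \<subseteq> set_mset ?M - PG q 1"
        using X3 by (simp add: M')
      then have "T \<notin> pg_span q 3 {X, frob q X, (frob q ^^ 2) X}"
        using r4 by (intro rational_meet_pt_notin_span[OF c _ ST(2) T(2)]) simp_all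
      ultimately show ?thesis using r4 X(1) by blast
    qed
    consider "weight q g P = 1" "orbit_size q P = 3" "weight q g Q = 1" "orbit_size q Q = 3"
      | "weight q g P = 1" "orbit_size q P = 3" "orbit_size q Q = 1"
      | "orbit_size q P = 1" "weight q g Q = 1" "orbit_size q Q = 3"
      | "orbit_size q P = 1" "orbit_size q Q = 1"
      using prods[OF two(4) weight_bounds] prods[OF two(5) weight_bounds] by blast
    then show ?thesis
    proof cases
      case 1
      obtain X where X: "X \<in> g" "orb P = {#X, frob q X, (frob q ^^ 2) X#}"
        using weight_1_orbit_3[OF P(2) 1(1,2)] .
      obtain Y where Y: "Y \<in> g" "orb Q = {#Y, frob q Y, (frob q ^^ 2) Y#}"
        using weight_1_orbit_3[OF Q(2) 1(3,4)] .
      have M': "?M = {#X, frob q X, (frob q ^^ 2) X, Y, frob q Y, (frob q ^^ 2) Y#}"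
        using two(3) X(2) Y(2) by simp
      have "set_mset ?M \<subseteq> PG q 3"
        using g3(1)[OF X(1), of 0] g3(1)[OF X(1), of 1] g3(1)[OF X(1), of 2]
          g3(1)[OF Y(1), of 0] g3(1)[OF Y(1), of 1] g3(1)[OF Y(1), of 2]
        by (simp add: M')
      then have "meet_pts_over q 3 r h c = ?M" by (rule over)
      moreover have "r = 6" using r unfolding M' by simp
      ultimately have ?C1 using X(1) Y(1) M' by metis
      then show ?thesis by blast
    next
      case 2
      then have ?C3 using mixed 2 two(1,2,3) by blast
      then show ?thesis by blast
    next
      case 3
      moreover have "?M = orb Q + orb P" using two(3) by (simp add: add.commute)
      ultimately have ?C3 using mixed two(1,2) by blast
      then show ?thesis by blast
    next
      case 4
      note P1 = orbit_1[OF P(1) 4(1)] and Q1 = orbit_1[OF Q(1) 4(2)]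
      have M': "?M = {#P, Q#}" using two(3) P1(3) Q1(3) by simp
      then have "meet_pts_over q 1 r h c = ?M" using P1(2) Q1(2) by (intro over) simp
      moreover have "r = 2" using r unfolding M' by simp
      ultimately have ?C5 using P1(1) Q1(1) M' by metis
      then show ?thesis by blast
    qed
  qed
qed

end
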